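(* \textsc{Maximum Happy Vertices} can be solved in time $(2d)^d\cdot n^{O(1)}$, where $n$ is the number of vertices of the input graph and $d$ is its distance to cluster graphs.
   Context: All graphs are finite, simple and undirected; $[\ell]=\{1,\dots,\ell\}$. Given a graph $G$ and a coloring $c: V(G)\to[\ell]$, a vertex $v$ is happy if $c(u)=c(v)$ for every neighbour $u$ of $v$. \textsc{Maximum Happy Vertices}: given a graph $G$, a partial coloring $p: S\to[\ell]$ for some $S\subseteq V(G)$, and an integer $k$, decide whether there is a coloring $c:V(G)\to[\ell]$ extending $p$ with at least $k$ happy vertices. A cluster graph is a disjoint union of cliques; the distance to cluster of $G$ is the minimum number of vertices whose deletion yields a cluster graph. *)

theory Defs
  imports "Graph_Theory.Pair_Digraph" "HOL-Library.Disjoint_Sets"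
begin

section \<open>Maximum Happy Vertices and distance to cluster\<close>

text \<open>A finite simple undirected graph is a \<^const>\<open>pair_graph\<close>: a finite, loop-free, symmetric set
  of vertex pairs.\<close>

definition happy :: "'a pair_pre_digraph \<Rightarrow> ('a \<Rightarrow> nat) \<Rightarrow> 'a \<Rightarrow> bool" where
  "happy G c v \<longleftrightarrow> (\<forall>u. (u, v) \<in> parcs G \<longrightarrow> c u = c v)"

definition mhv_instance :: "'a pair_pre_digraph \<Rightarrow> nat \<Rightarrow> ('a \<rightharpoonup> nat) \<Rightarrow> bool" where
  "mhv_instance G l p \<longleftrightarrow> pair_graph G \<and> dom p \<subseteq> pverts G \<and> ran p \<subseteq> {1..l}"

definition extends_colouring :: "('a \<Rightarrow> nat) \<Rightarrow> ('a \<rightharpoonup> nat) \<Rightarrow> bool" where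
  "extends_colouring c p \<longleftrightarrow> (\<forall>v\<in>dom p. p v = Some (c v))"

definition max_happy_vertices :: "'a pair_pre_digraph \<Rightarrow> nat \<Rightarrow> ('a \<rightharpoonup> nat) \<Rightarrow> int \<Rightarrow> bool" where
  "max_happy_vertices G l p k \<longleftrightarrow>
    (\<exists>c. c ` pverts G \<subseteq> {1..l} \<and> extends_colouring c p \<and> k \<le> int (card {v \<in> pverts G. happy G c v}))"

definition delete_verts :: "'a pair_pre_digraph \<Rightarrow> 'a set \<Rightarrow> 'a pair_pre_digraph" where
  "delete_verts G X =
    \<lparr>pverts = pverts G - X, parcs = {(u, v) \<in> parcs G. u \<notin> X \<and> v \<notin> X}\<rparr>"

text \<open>The blocks of the partition are the vertex sets of the cliques.\<close>

definition cluster_graph :: "'a pair_pre_digraph \<Rightarrow> bool" where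
  "cluster_graph G \<longleftrightarrow>
    (\<exists>\<C>. partition_on (pverts G) \<C> \<and>
      (\<forall>u v. (u, v) \<in> parcs G \<longleftrightarrow> u \<noteq> v \<and> (\<exists>C\<in>\<C>. u \<in> C \<and> v \<in> C)))"

definition distance_to_cluster :: "'a pair_pre_digraph \<Rightarrow> nat" where
  "distance_to_cluster G =
    (LEAST d. \<exists>X \<subseteq> pverts G. card X = d \<and> cluster_graph (delete_verts G X))"

text \<open>The minimum is over a nonempty set, so the \<^bold>\<open>LEAST\<close> above is attained.\<close>

lemma distance_to_cluster_attained:
  assumes "pair_graph G"
  shows "\<exists>X \<subseteq> pverts G. card X = distance_to_cluster G \<and> cluster_graph (delete_verts G X)"
proof -
  interpret pair_graph G by fact
  have "cluster_graph (delete_verts G (pverts G))"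
    unfolding cluster_graph_def delete_verts_def
    by (intro exI[of _ "{}"]) (auto simp: partition_on_def dest: arc_fst_in_verts)
  then have "\<exists>d. \<exists>X \<subseteq> pverts G. card X = d \<and> cluster_graph (delete_verts G X)"
    by blast
  from LeastI_ex[OF this] show ?thesis
    unfolding distance_to_cluster_def .
qed


section \<open>Random access machines\<close>

text \<open>
  The random access machine of Cook and Reckhow under the uniform cost measure: registers hold
  integers, the only arithmetic operations are addition and subtraction, and each executed
  instruction costs one time unit. Registers are indexed by integers rather than by naturals, so
  that indirect addressing is defined for every address. Instead of reading an input tape, the
  machine starts with its input in the registers. It halts once the program counter lies outside
  the program.
\<close>

datatype instr =
    Const int int       \<comment> \<open>\<open>X\<^sub>i \<leftarrow> c\<close>\<close>
  | Add int int int     \<comment> \<open>\<open>X\<^sub>i \<leftarrow> X\<^sub>j + X\<^sub>k\<close>\<close>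
  | Sub int int int     \<comment> \<open>\<open>X\<^sub>i \<leftarrow> X\<^sub>j - X\<^sub>k\<close>\<close>
  | Load int int        \<comment> \<open>\<open>X\<^sub>i \<leftarrow> X\<^bsub>X\<^sub>j\<^esub>\<close>\<close>
  | Store int int       \<comment> \<open>\<open>X\<^bsub>X\<^sub>i\<^esub> \<leftarrow> X\<^sub>j\<close>\<close>
  | JumpPos nat int     \<comment> \<open>jump to instruction \<open>m\<close> if \<open>X\<^sub>j > 0\<close>\<close>

type_synonym memory = "int \<Rightarrow> int"
type_synonym config = "nat \<times> memory"

fun exec_instr :: "instr \<Rightarrow> config \<Rightarrow> config" where
  "exec_instr (Const i c) (pc, X) = (Suc pc, X(i := c))"
| "exec_instr (Add i j k) (pc, X) = (Suc pc, X(i := X j + X k))"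
| "exec_instr (Sub i j k) (pc, X) = (Suc pc, X(i := X j - X k))"
| "exec_instr (Load i j) (pc, X) = (Suc pc, X(i := X (X j)))"
| "exec_instr (Store i j) (pc, X) = (Suc pc, X(X i := X j))"
| "exec_instr (JumpPos m j) (pc, X) = (if X j > 0 then m else Suc pc, X)"

definition halted :: "instr list \<Rightarrow> config \<Rightarrow> bool" where
  "halted P s \<longleftrightarrow> length P \<le> fst s"

definition ram_step :: "instr list \<Rightarrow> config \<Rightarrow> config" where
  "ram_step P s = (if halted P s then s else exec_instr (P ! fst s) s)"

text \<open>Started on the given memory, the program halts after at most \<open>T\<close> steps, leaving the truth
  value of \<open>b\<close> in register 0.\<close>

definition ram_decides_within :: "instr list \<Rightarrow> memory \<Rightarrow> bool \<Rightarrow> nat \<Rightarrow> bool" where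
  "ram_decides_within P X b T \<longleftrightarrow>
    (\<exists>t \<le> T. let s = (ram_step P ^^ t) (0, X) in halted P s \<and> snd s 0 = (if b then 1 else 0))"


section \<open>Input encoding\<close>

text \<open>
  For a graph on the vertex set \<open>{..<n}\<close>, the registers from 0 on contain \<open>n\<close>, the number \<open>l\<close> of
  colours, the threshold \<open>k\<close>, the \<open>n\<close> entries of the precolouring (0 for an uncoloured vertex), and
  the adjacency matrix in row-major order. All other registers are 0.
\<close>

definition mhv_input ::
    "nat \<Rightarrow> nat pair_pre_digraph \<Rightarrow> nat \<Rightarrow> (nat \<rightharpoonup> nat) \<Rightarrow> int \<Rightarrow> memory" where
  "mhv_input n G l p k a =
    (if a = 0 then int n
     else if a = 1 then int l
     else if a = 2 then k
     else if 3 \<le> a \<and> a < 3 + int n then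
       (case p (nat (a - 3)) of None \<Rightarrow> 0 | Some j \<Rightarrow> int j)
     else if 3 + int n \<le> a \<and> a < 3 + int n + int n * int n then
       (let b = nat (a - 3 - int n) in if (b div n, b mod n) \<in> parcs G then 1 else 0)
     else 0)"

end

theory Submission
  imports Defs
begin

text \<open>
  A set \<open>X\<close> of \<open>d\<close> vertices whose deletion leaves a cluster graph is found by branching three ways on
  an induced path with three vertices, for increasing \<open>d\<close>. Then one guesses which vertices of \<open>X\<close> are
  happy and which of them have equal colours; these are at most \<open>(2 d)^d\<close> guesses. For a group \<open>j\<close> of
  equally coloured vertices of \<open>X\<close>, let its gain under the colour \<open>a\<close> be the number of vertices that
  become happy because \<open>j\<close> is coloured \<open>a\<close>, in those cliques whose precoloured vertices all have the
  colour \<open>a\<close>. The gains of different groups add up, even if two groups receive the same colour, so no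
  matching of groups with colours is needed: each group takes the colour that is forced on it by a
  precoloured vertex, or else the precolour of largest gain. A clique without precoloured vertices
  takes the colour of the group that makes most of its vertices happy. The resulting colouring is as
  good as any that agrees with the guess, and the machine checks it explicitly, so a positive answer
  is always correct.

  The machine is obtained by compiling a total loop language; since its registers hold arbitrary
  integers at unit cost, it needs no data structures besides integers, and both exponential
  searches are plain loops over numbers.
\<close>

section \<open>A loop language and its compilation\<close>

text \<open>The base \<open>2 * d\<close> arises because each vertex of \<open>X\<close> carries one
  of \<open>d\<close> group numbers and one bit for its happiness, so a guess is a number with
  \<open>d\<close> digits. The branching costs \<open>3 ^ d\<close>, which is at most
  \<open>2 * (2 * d) ^ d\<close>.

  The gains add up for the following reason. A happy vertex off \<open>X\<close> has the colour of
  its whole clique, hence also of its neighbours in \<open>X\<close> and of the happy vertices of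
  \<open>X\<close> next to its clique. If there are such vertices of \<open>X\<close>, they all lie
  in one group, so the vertex is counted for this group only. Groups that happen to share a colour
  can only make further vertices happy. A clique with two different precolours contains no happy
  vertex at all. A colour that is nobody's precolour gains nothing, so at most \<open>n\<close>
  colours compete for a group and the running time does not depend on \<open>l\<close>.

  The order of the branching search matters for its cost: it is bounded in terms of the distance
  only because sizes are tried in increasing order and nothing is evaluated after the first
  success.\<close>

datatype ex =
    Num int
  | Var nat
  | Plus ex ex
  | Minus ex ex
  | Read ex
  | Cond ex ex ex
  | Bind ex ex
  | Ren "nat \<Rightarrow> nat" ex
  | Rec ex ex ex

type_synonym env = "nat \<Rightarrow> int"

fun recur :: "(int \<Rightarrow> int \<Rightarrow> int) \<Rightarrow> int \<Rightarrow> nat \<Rightarrow> int" where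
  "recur f a 0 = a"
| "recur f a (Suc i) = f (int i) (recur f a i)"

text \<open>Variables are de Bruijn indices: a binder puts its value at index 0 and shifts the
  others. A loop body finds its counter at 0 and its accumulator at 1.\<close>

abbreviation push :: "'a \<Rightarrow> (nat \<Rightarrow> 'a) \<Rightarrow> nat \<Rightarrow> 'a" where
  "push \<equiv> case_nat"

text \<open>\<open>Read\<close> clamps its address because the negative addresses belong to the compiled code.\<close>

fun eval :: "memory \<Rightarrow> env \<Rightarrow> ex \<Rightarrow> int" where
  "eval M v (Num c) = c"
| "eval M v (Var i) = v i"
| "eval M v (Plus a b) = eval M v a + eval M v b"
| "eval M v (Minus a b) = eval M v a - eval M v b"
| "eval M v (Read a) = M (max 0 (eval M v a))"
| "eval M v (Cond c a b) = (if eval M v c > 0 then eval M v a else eval M v b)"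
| "eval M v (Bind a b) = eval M (push (eval M v a) v) b"
| "eval M v (Ren r a) = eval M (\<lambda>i. v (r i)) a"
| "eval M v (Rec N a b) =
    recur (\<lambda>i x. eval M (push i (push x v)) b) (eval M v a) (nat (eval M v N))"

text \<open>An upper bound on the steps of the compiled code: both outcomes of the test in
  \<open>Read\<close> and of the test in \<open>Cond\<close> are charged the overhead of the longer
  one. Each round of a loop pays 7 steps besides its body, one for the exit test and six for
  bookkeeping.\<close>

fun cost :: "memory \<Rightarrow> env \<Rightarrow> ex \<Rightarrow> nat" where
  "cost M v (Num c) = 1"
| "cost M v (Var i) = 2"
| "cost M v (Plus a b) = cost M v a + cost M v b + 1"
| "cost M v (Minus a b) = cost M v a + cost M v b + 1"
| "cost M v (Read a) = cost M v a + 5"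
| "cost M v (Cond c a b) = cost M v c + 3 + (if eval M v c > 0 then cost M v a else cost M v b)"
| "cost M v (Bind a b) = cost M v a + cost M (push (eval M v a) v) b + 2"
| "cost M v (Ren r a) = cost M (\<lambda>i. v (r i)) a"
| "cost M v (Rec N a b) = cost M v N + cost M v a + 6 +
    (\<Sum>i<nat (eval M v N). 7 +
      cost M (push (int i) (push (recur (\<lambda>i x. eval M (push i (push x v)) b) (eval M v a) i) v)) b)"

fun code_length :: "ex \<Rightarrow> nat" where
  "code_length (Num c) = 1"
| "code_length (Var i) = 2"
| "code_length (Plus a b) = code_length a + code_length b + 1"
| "code_length (Minus a b) = code_length a + code_length b + 1"
| "code_length (Read a) = code_length a + 5"
| "code_length (Cond c a b) = code_length c + code_length a + code_length b + 3"
| "code_length (Bind a b) = code_length a + code_length b + 2"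
| "code_length (Ren r a) = code_length a"
| "code_length (Rec N a b) = code_length N + code_length a + code_length b + 12"

text \<open>The nonnegative addresses hold the input, so the registers of the compiled code are the
  negative ones. \<open>loc\<close> maps variables to registers, and \<open>q\<close> is the address of the code.\<close>

abbreviation reg :: "nat \<Rightarrow> int" where
  "reg t \<equiv> - 1 - int t"

fun compile :: "ex \<Rightarrow> (nat \<Rightarrow> nat) \<Rightarrow> nat \<Rightarrow> nat \<Rightarrow> instr list" where
  "compile (Num c) loc t q = [Const (reg t) c]"
| "compile (Var i) loc t q = [Const (reg t) 0, Add (reg t) (reg t) (reg (loc i))]"
| "compile (Plus a b) loc t q =
    compile a loc t q @ compile b loc (t + 1) (q + code_length a) @
    [Add (reg t) (reg t) (reg (t + 1))]"
| "compile (Minus a b) loc t q =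
    compile a loc t q @ compile b loc (t + 1) (q + code_length a) @
    [Sub (reg t) (reg t) (reg (t + 1))]"
| "compile (Read a) loc t q =
    compile a loc t q @
    [Const (reg (t + 1)) 1, Add (reg (t + 1)) (reg (t + 1)) (reg t),
     JumpPos (q + code_length a + 4) (reg (t + 1)), Const (reg t) 0, Load (reg t) (reg t)]"
| "compile (Cond c a b) loc t q =
    (let q1 = q + code_length c + 1; q2 = q1 + code_length b + 2; q3 = q2 + code_length a in
     compile c loc t q @ [JumpPos q2 (reg t)] @ compile b loc t q1 @
     [Const (reg (t + 1)) 1, JumpPos q3 (reg (t + 1))] @ compile a loc t q2)"
| "compile (Bind a b) loc t q =
    compile a loc t q @ compile b (push t loc) (t + 1) (q + code_length a) @
    [Const (reg t) 0, Add (reg t) (reg t) (reg (t + 1))]"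
| "compile (Ren r a) loc t q = compile a (\<lambda>i. loc (r i)) t q"
| "compile (Rec N a b) loc t q =
    (let q1 = q + code_length N + 1; q2 = q1 + code_length a; q3 = q2 + 3; q4 = q3 + code_length b in
     compile N loc t q @ [Const (reg (t + 1)) 0] @ compile a loc (t + 2) q1 @
     [JumpPos q3 (reg t), Const (reg (t + 3)) 1, JumpPos (q4 + 6) (reg (t + 3))] @
     compile b (push (t + 1) (push (t + 2) loc)) (t + 3) q3 @
     [Const (reg (t + 2)) 0, Add (reg (t + 2)) (reg (t + 2)) (reg (t + 3)),
      Const (reg (t + 3)) 1, Add (reg (t + 1)) (reg (t + 1)) (reg (t + 3)),
      Sub (reg t) (reg t) (reg (t + 3)), JumpPos q2 (reg (t + 3)),
      Const (reg t) 0, Add (reg t) (reg t) (reg (t + 2))])"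

lemma length_compile [simp]: "length (compile e loc t q) = code_length e"
  by (induction e arbitrary: loc t q) (auto simp: Let_def)

section \<open>Runs of the machine and code embedded in a program\<close>

definition reaches :: "instr list \<Rightarrow> config \<Rightarrow> nat \<Rightarrow> config \<Rightarrow> bool" where
  "reaches P s T s' \<longleftrightarrow> (\<exists>t\<le>T. (ram_step P ^^ t) s = s')"

lemma reaches_refl: "reaches P s T s"
  unfolding reaches_def by (intro exI[of _ 0]) auto

lemma reaches_eq: "s = s' \<Longrightarrow> reaches P s 0 s'"
  using reaches_refl by simp

lemma reaches_trans: "reaches P s T s' \<Longrightarrow> reaches P s' T' s'' \<Longrightarrow> reaches P s (T + T') s''"
  unfolding reaches_def
proof (elim exE conjE)
  fix t t'
  assume "t \<le> T" "(ram_step P ^^ t) s = s'" "t' \<le> T'" "(ram_step P ^^ t') s' = s''"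
  then show "\<exists>t\<le>T + T'. (ram_step P ^^ t) s = s''"
    by (intro exI[of _ "t' + t"]) (auto simp: funpow_add)
qed

lemma reaches_mono: "reaches P s T s' \<Longrightarrow> T \<le> T' \<Longrightarrow> reaches P s T' s'"
  unfolding reaches_def using order_trans by blast

lemma reaches_step:
  assumes "q < length P" "reaches P (exec_instr (P ! q) (q, X)) T s'"
  shows "reaches P (q, X) (Suc T) s'"
proof -
  have "reaches P (q, X) 1 (exec_instr (P ! q) (q, X))"
    unfolding reaches_def using assms(1)
    by (intro exI[of _ 1]) (auto simp: ram_step_def halted_def)
  from reaches_trans[OF this assms(2)] show ?thesis by simp
qed

definition code_at :: "instr list \<Rightarrow> nat \<Rightarrow> instr list \<Rightarrow> bool" where
  "code_at P q cs \<longleftrightarrow> (\<exists>pre post. P = pre @ cs @ post \<and> length pre = q)"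

lemma code_at_append:
  "code_at P q (cs @ cs') \<longleftrightarrow> code_at P q cs \<and> code_at P (q + length cs) cs'"
proof
  assume "code_at P q (cs @ cs')"
  then obtain pre post where P: "P = pre @ (cs @ cs') @ post" "length pre = q"
    unfolding code_at_def by blast
  have "P = pre @ cs @ (cs' @ post)" "P = (pre @ cs) @ cs' @ post" using P by auto
  then show "code_at P q cs \<and> code_at P (q + length cs) cs'"
    unfolding code_at_def using P(2) by (metis length_append)
next
  assume "code_at P q cs \<and> code_at P (q + length cs) cs'"
  then obtain pre post pre' post' where
    P: "P = pre @ cs @ post" "length pre = q" and
    P': "P = pre' @ cs' @ post'" "length pre' = q + length cs"
    unfolding code_at_def by blast
  have "pre' = pre @ cs" using P P' by (metis append_assoc append_eq_append_conv length_append)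
  then show "code_at P q (cs @ cs')"
    unfolding code_at_def using P P' by (intro exI[of _ pre] exI[of _ post']) auto
qed

lemma code_at_Nil: "code_at P q [] \<longleftrightarrow> q \<le> length P"
proof
  assume "q \<le> length P"
  then have "P = take q P @ [] @ drop q P" "length (take q P) = q" by auto
  then show "code_at P q []" unfolding code_at_def by blast
qed (auto simp: code_at_def)

lemma code_at_le: "code_at P q cs \<Longrightarrow> q \<le> length P"
  unfolding code_at_def by auto

lemma code_at_Cons:
  "code_at P q (c # cs) \<longleftrightarrow> q < length P \<and> P ! q = c \<and> code_at P (Suc q) cs"
proof
  assume "code_at P q (c # cs)"
  then obtain pre post where P: "P = pre @ (c # cs) @ post" "length pre = q"
    unfolding code_at_def by blast
  then have "P = (pre @ [c]) @ cs @ post" by auto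
  then show "q < length P \<and> P ! q = c \<and> code_at P (Suc q) cs"
    using P unfolding code_at_def
    by (metis append_Cons length_append_singleton length_append length_Cons less_add_Suc1
        nth_append_length)
next
  assume a: "q < length P \<and> P ! q = c \<and> code_at P (Suc q) cs"
  then obtain pre post where P: "P = pre @ cs @ post" "length pre = Suc q"
    unfolding code_at_def by blast
  then have "pre = take q pre @ [c]"
    using a by (metis append_take_drop_id lessI nth_append take_Suc_conv_app_nth take_all order_refl)
  then show "code_at P q (c # cs)"
    unfolding code_at_def using P
    by (metis append.assoc append_Cons append_Nil diff_Suc_1 length_append_singleton)
qed

definition computes ::
    "instr list \<Rightarrow> nat \<Rightarrow> nat \<Rightarrow> nat \<Rightarrow> nat \<Rightarrow> memory \<Rightarrow> int \<Rightarrow> bool" where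
  "computes P q q' t T X r \<longleftrightarrow>
    (\<exists>X'. reaches P (q, X) T (q', X') \<and> X' (reg t) = r \<and> (\<forall>a > reg t. X' a = X a))"

lemma computesI:
  "reaches P (q, X) T (q', X') \<Longrightarrow> X' (reg t) = r \<Longrightarrow> (\<And>a. a > reg t \<Longrightarrow> X' a = X a) \<Longrightarrow>
    computes P q q' t T X r"
  unfolding computes_def by blast

text \<open>The memory below address \<open>reg t\<close> is free, the memory above it is preserved, so the
  input and the variables survive.\<close>

lemma compile_correct:
  assumes "code_at P q (compile e loc t q)"
    and "\<And>i. loc i < t" and "\<And>i. X (reg (loc i)) = v i" and "\<And>a. a \<ge> 0 \<Longrightarrow> X a = M a"
  shows "computes P q (q + code_length e) t (cost M v e) X (eval M v e)"
  using assms
proof (induction e arbitrary: q loc t X v)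
  case (Num c)
  then show ?case
    by (intro computesI[where X' = "X(reg t := c)"])
       (auto simp: code_at_Cons intro!: reaches_step reaches_eq)
next
  case (Var i)
  have "loc i \<noteq> t" using Var(2)[of i] by auto
  with Var show ?case
    by (intro computesI[where X' = "X(reg t := v i)"])
       (auto simp: code_at_Cons numeral_2_eq_2 intro!: reaches_step reaches_eq)
next
  case (Plus a b)
  from Plus.prems(1) have c: "code_at P q (compile a loc t q)"
      "code_at P (q + code_length a) (compile b loc (t + 1) (q + code_length a))"
      "code_at P (q + code_length a + code_length b) [Add (reg t) (reg t) (reg (t + 1))]"
    by (auto simp: code_at_append)
  from Plus.IH(1)[OF c(1) Plus.prems(2-)] obtain X1 where
    X1: "reaches P (q, X) (cost M v a) (q + code_length a, X1)" "X1 (reg t) = eval M v a"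
      "\<And>a. a > reg t \<Longrightarrow> X1 a = X a" unfolding computes_def by blast
  have "\<And>i. loc i < t + 1" "\<And>i. X1 (reg (loc i)) = v i" "\<And>a. a \<ge> 0 \<Longrightarrow> X1 a = M a"
    using Plus.prems(2-) X1(3) by (auto simp: less_SucI)
  from Plus.IH(2)[OF c(2) this] obtain X2 where
    X2: "reaches P (q + code_length a, X1) (cost M v b) (q + code_length a + code_length b, X2)"
      "X2 (reg (t + 1)) = eval M v b" "\<And>a. a > reg (t + 1) \<Longrightarrow> X2 a = X1 a"
    unfolding computes_def by blast
  have "reaches P (q + code_length a + code_length b, X2) 1
      (Suc (q + code_length a + code_length b), X2(reg t := eval M v a + eval M v b))"
    using c(3) X1(2) X2(2) X2(3)[of "reg t"]
    by (auto simp: code_at_Cons simp del: of_nat_add intro!: reaches_step reaches_eq)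
  from reaches_trans[OF reaches_trans[OF X1(1) X2(1)] this] show ?case
    by (intro computesI[where X' = "X2(reg t := eval M v a + eval M v b)"])
       (auto simp: X1 X2 add.assoc)
next
  case (Minus a b)
  from Minus.prems(1) have c: "code_at P q (compile a loc t q)"
      "code_at P (q + code_length a) (compile b loc (t + 1) (q + code_length a))"
      "code_at P (q + code_length a + code_length b) [Sub (reg t) (reg t) (reg (t + 1))]"
    by (auto simp: code_at_append)
  from Minus.IH(1)[OF c(1) Minus.prems(2-)] obtain X1 where
    X1: "reaches P (q, X) (cost M v a) (q + code_length a, X1)" "X1 (reg t) = eval M v a"
      "\<And>a. a > reg t \<Longrightarrow> X1 a = X a" unfolding computes_def by blast
  have "\<And>i. loc i < t + 1" "\<And>i. X1 (reg (loc i)) = v i" "\<And>a. a \<ge> 0 \<Longrightarrow> X1 a = M a"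
    using Minus.prems(2-) X1(3) by (auto simp: less_SucI)
  from Minus.IH(2)[OF c(2) this] obtain X2 where
    X2: "reaches P (q + code_length a, X1) (cost M v b) (q + code_length a + code_length b, X2)"
      "X2 (reg (t + 1)) = eval M v b" "\<And>a. a > reg (t + 1) \<Longrightarrow> X2 a = X1 a"
    unfolding computes_def by blast
  have "reaches P (q + code_length a + code_length b, X2) 1
      (Suc (q + code_length a + code_length b), X2(reg t := eval M v a - eval M v b))"
    using c(3) X1(2) X2(2) X2(3)[of "reg t"]
    by (auto simp: code_at_Cons simp del: of_nat_add intro!: reaches_step reaches_eq)
  from reaches_trans[OF reaches_trans[OF X1(1) X2(1)] this] show ?case
    by (intro computesI[where X' = "X2(reg t := eval M v a - eval M v b)"])
       (auto simp: X1 X2 add.assoc)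
next
  case (Read a)
  let ?q = "q + code_length a"
  from Read.prems(1) have c: "code_at P q (compile a loc t q)"
      "code_at P ?q [Const (reg (t + 1)) 1, Add (reg (t + 1)) (reg (t + 1)) (reg t),
     JumpPos (?q + 4) (reg (t + 1)), Const (reg t) 0, Load (reg t) (reg t)]"
    by (auto simp: code_at_append)
  from Read.IH[OF c(1) Read.prems(2-)] obtain X1 where
    X1: "reaches P (q, X) (cost M v a) (?q, X1)" "X1 (reg t) = eval M v a"
      "\<And>a. a > reg t \<Longrightarrow> X1 a = X a" unfolding computes_def by blast
  define Y where "Y = X1(reg (t + 1) := 1 + eval M v a, reg t := M (max 0 (eval M v a)))"
  have M: "X1 a = M a" if "a \<ge> 0" for a using X1(3)[of a] Read.prems(4) that by simp
  have "reaches P (?q, X1) 5 (?q + 5, Y)"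
  \<comment> \<open>The code tests the address plus 1, because \<open>JumpPos\<close> is strict. A
    nonnegative address skips the instruction that resets it to 0, which saves one step.\<close>
  proof (cases "eval M v a \<ge> 0")
    case True
    have "reaches P (?q, X1) 4 (?q + 5, Y)"
      using c(2) X1(2) True M
      by (auto simp: code_at_Cons eval_nat_numeral Y_def fun_eq_iff
          simp del: of_nat_add intro!: reaches_step reaches_eq)
    then show ?thesis by (rule reaches_mono) simp
  next
    case False
    then show ?thesis
      using c(2) X1(2) M
      by (auto simp: code_at_Cons eval_nat_numeral Y_def fun_eq_iff
          simp del: of_nat_add intro!: reaches_step reaches_eq)
  qed
  from reaches_trans[OF X1(1) this] show ?case
    by (intro computesI[where X' = Y]) (auto simp: Y_def X1 add.assoc)
next
  case (Cond c a b)
  let ?q0 = "q + code_length c"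
  let ?q1 = "?q0 + 1"
  let ?q1' = "?q1 + code_length b"
  let ?q2 = "?q1' + 2"
  let ?q3 = "?q2 + code_length a"
  from Cond.prems(1) have d: "code_at P q (compile c loc t q)"
      "code_at P ?q0 [JumpPos ?q2 (reg t)]" "code_at P ?q1 (compile b loc t ?q1)"
      "code_at P ?q1' [Const (reg (t + 1)) 1, JumpPos ?q3 (reg (t + 1))]"
      "code_at P ?q2 (compile a loc t ?q2)"
    by (auto simp: code_at_append code_at_Cons code_at_Nil Let_def add_ac dest: code_at_le)
  from Cond.IH(1)[OF d(1) Cond.prems(2-)] obtain X1 where
    X1: "reaches P (q, X) (cost M v c) (?q0, X1)" "X1 (reg t) = eval M v c"
      "\<And>a. a > reg t \<Longrightarrow> X1 a = X a" unfolding computes_def by blast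
  have p: "\<And>i. X1 (reg (loc i)) = v i" "\<And>a. a \<ge> 0 \<Longrightarrow> X1 a = M a"
    using Cond.prems(2-) X1(3) by auto
  show ?case
  proof (cases "eval M v c > 0")
    case True
    from Cond.IH(2)[OF d(5) Cond.prems(2) p] obtain X2 where
      X2: "reaches P (?q2, X1) (cost M v a) (?q3, X2)"
        "X2 (reg t) = eval M v a" "\<And>a. a > reg t \<Longrightarrow> X2 a = X1 a"
      unfolding computes_def by auto
    have "reaches P (?q0, X1) 1 (?q2, X1)"
      using d(2) X1(2) True
      by (auto simp: code_at_Cons simp del: of_nat_add intro!: reaches_step reaches_eq)
    from reaches_trans[OF X1(1) reaches_trans[OF this X2(1)]] True
    have "reaches P (q, X) (cost M v (Cond c a b)) (q + code_length (Cond c a b), X2)"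
      by (auto simp: add_ac eval_nat_numeral elim!: reaches_mono)
    with True show ?thesis
      by (intro computesI[where X' = X2]) (auto simp: X1 X2)
  next
    case False
    from Cond.IH(3)[OF d(3) Cond.prems(2) p] obtain X2 where
      X2: "reaches P (?q1, X1) (cost M v b) (?q1', X2)"
        "X2 (reg t) = eval M v b" "\<And>a. a > reg t \<Longrightarrow> X2 a = X1 a"
      unfolding computes_def by auto
    have 1: "reaches P (?q0, X1) 1 (?q1, X1)"
      using d(2) X1(2) False
      by (auto simp: code_at_Cons simp del: of_nat_add intro!: reaches_step reaches_eq)
    have "reaches P (?q1', X2) 2 (?q3, X2(reg (t + 1) := 1))"
      using d(4)
      by (auto simp: code_at_Cons eval_nat_numeral fun_eq_iff simp del: of_nat_add
          intro!: reaches_step reaches_eq)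
    from reaches_trans[OF X1(1) reaches_trans[OF 1 reaches_trans[OF X2(1) this]]] False
    have "reaches P (q, X) (cost M v (Cond c a b))
        (q + code_length (Cond c a b), X2(reg (t + 1) := 1))"
      by (auto simp: add_ac eval_nat_numeral elim!: reaches_mono)
    with False show ?thesis
      by (intro computesI[where X' = "X2(reg (t + 1) := 1)"]) (auto simp: X1 X2)
  qed
next
  case (Bind a b)
  from Bind.prems(1) have c: "code_at P q (compile a loc t q)"
      "code_at P (q + code_length a) (compile b (push t loc) (t + 1) (q + code_length a))"
      "code_at P (q + code_length a + code_length b)
        [Const (reg t) 0, Add (reg t) (reg t) (reg (t + 1))]"
    by (auto simp: code_at_append)
  from Bind.IH(1)[OF c(1) Bind.prems(2-)] obtain X1 where
    X1: "reaches P (q, X) (cost M v a) (q + code_length a, X1)" "X1 (reg t) = eval M v a"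
      "\<And>a. a > reg t \<Longrightarrow> X1 a = X a" unfolding computes_def by blast
  have "\<And>i. push t loc i < t + 1" "\<And>i. X1 (reg (push t loc i)) = push (eval M v a) v i"
    "\<And>a. a \<ge> 0 \<Longrightarrow> X1 a = M a"
    using Bind.prems(2-) X1(2,3) by (auto simp: less_SucI split: nat.split)
  from Bind.IH(2)[OF c(2) this] obtain X2 where
    X2: "reaches P (q + code_length a, X1) (cost M (push (eval M v a) v) b)
        (q + code_length a + code_length b, X2)"
      "X2 (reg (t + 1)) = eval M (push (eval M v a) v) b" "\<And>a. a > reg (t + 1) \<Longrightarrow> X2 a = X1 a"
    unfolding computes_def by blast
  have "reaches P (q + code_length a + code_length b, X2) 2
      (q + code_length a + code_length b + 2, X2(reg t := eval M (push (eval M v a) v) b))"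
    using c(3) X2(2)
    by (auto simp: code_at_Cons eval_nat_numeral fun_eq_iff simp del: of_nat_add
        intro!: reaches_step reaches_eq)
  from reaches_trans[OF X1(1) reaches_trans[OF X2(1) this]] show ?case
    by (intro computesI[where X' = "X2(reg t := eval M (push (eval M v a) v) b)"])
       (auto simp: X1 X2 add.assoc)
next
  case (Ren r a)
  then show ?case by simp
next
  case (Rec N a b)
  let ?q0 = "q + code_length N"
  let ?q1 = "?q0 + 1"
  let ?q2 = "?q1 + code_length a"
  let ?q3 = "?q2 + 3"
  let ?q4 = "?q3 + code_length b"
  let ?loc = "push (t + 1) (push (t + 2) loc)"
  define k where "k = nat (eval M v N)"
  define r where "r = recur (\<lambda>i x. eval M (push i (push x v)) b) (eval M v a)"
  define cb where "cb i = cost M (push (int i) (push (r i) v)) b" for i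
  from Rec.prems(1) have c: "code_at P q (compile N loc t q)"
      "code_at P ?q0 [Const (reg (t + 1)) 0]" "code_at P ?q1 (compile a loc (t + 2) ?q1)"
      "code_at P ?q2 [JumpPos ?q3 (reg t), Const (reg (t + 3)) 1, JumpPos (?q4 + 6) (reg (t + 3))]"
      "code_at P ?q3 (compile b ?loc (t + 3) ?q3)"
      "code_at P ?q4 [Const (reg (t + 2)) 0, Add (reg (t + 2)) (reg (t + 2)) (reg (t + 3)),
        Const (reg (t + 3)) 1, Add (reg (t + 1)) (reg (t + 1)) (reg (t + 3)),
        Sub (reg t) (reg t) (reg (t + 3)), JumpPos ?q2 (reg (t + 3))]"
      "code_at P (?q4 + 6) [Const (reg t) 0, Add (reg t) (reg t) (reg (t + 2))]"
    by (auto simp: code_at_append code_at_Cons code_at_Nil Let_def eval_nat_numeral dest: code_at_le)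
  from Rec.IH(1)[OF c(1) Rec.prems(2-)] obtain X1 where
    X1: "reaches P (q, X) (cost M v N) (?q0, X1)" "X1 (reg t) = eval M v N"
      "\<And>a. a > reg t \<Longrightarrow> X1 a = X a" unfolding computes_def by blast
  have s1: "reaches P (?q0, X1) 1 (?q1, X1(reg (t + 1) := 0))"
    using c(2) by (auto simp: code_at_Cons simp del: of_nat_add intro!: reaches_step reaches_eq)
  define X1' where "X1' = X1(reg (t + 1) := 0)"
  have "\<And>i. loc i < t + 2" "\<And>i. X1' (reg (loc i)) = v i" "\<And>a. a \<ge> 0 \<Longrightarrow> X1' a = M a"
    subgoal for i using Rec.prems(2)[of i] by simp
    subgoal for i using Rec.prems(2)[of i] Rec.prems(3)[of i] X1(3) by (simp add: X1'_def)
    subgoal for i using Rec.prems(4)[of i] X1(3) by (simp add: X1'_def)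
    done
  from Rec.IH(2)[OF c(3) this] obtain X2 where
    X2: "reaches P (?q1, X1') (cost M v a) (?q2, X2)" "X2 (reg (t + 2)) = eval M v a"
      "\<And>a. a > reg (t + 2) \<Longrightarrow> X2 a = X1' a" unfolding computes_def by auto
  \<comment> \<open>Invariant at the loop head: \<open>reg t\<close> holds the number of rounds
    left, \<open>reg (t + 1)\<close> the counter and \<open>reg (t + 2)\<close> the accumulator; the
    body works from \<open>reg (t + 3)\<close> on. A negative bound gives no round, in accordance
    with \<open>nat\<close> in \<open>eval\<close>.\<close>
  have loop: "\<exists>Y. reaches P (?q2, X2) (\<Sum>j<i. 7 + cb j) (?q2, Y) \<and> Y (reg t) = eval M v N - int i
      \<and> Y (reg (t + 1)) = int i \<and> Y (reg (t + 2)) = r i \<and> (\<forall>a > reg t. Y a = X a)"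
    if "i \<le> k" for i
    using that
  proof (induction i)
    case 0
    have "X2 a = X a" if "a > reg t" for a using that X2(3) X1(3) by (simp add: X1'_def)
    moreover have "X2 (reg t) = eval M v N" "X2 (reg (t + 1)) = 0" using X2(3) X1(2)
        by (auto simp: X1'_def)
    ultimately show ?case using X2(2) reaches_refl by (intro exI[of _ X2]) (auto simp: r_def)
  next
    case (Suc i)
    then obtain Y where Y: "reaches P (?q2, X2) (\<Sum>j<i. 7 + cb j) (?q2, Y)"
        "Y (reg t) = eval M v N - int i" "Y (reg (t + 1)) = int i" "Y (reg (t + 2)) = r i"
        "\<And>a. a > reg t \<Longrightarrow> Y a = X a" by auto
    have "Y (reg t) > 0" using Y(2) Suc.prems by (auto simp: k_def)
    then have s: "reaches P (?q2, Y) 1 (?q3, Y)"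
      using c(4) by (auto simp: code_at_Cons simp del: of_nat_add intro!: reaches_step reaches_eq)
    have "\<And>i. ?loc i < t + 3" "\<And>j. Y (reg (?loc j)) = push (int i) (push (r i) v) j"
      "\<And>a. a \<ge> 0 \<Longrightarrow> Y a = M a"
      subgoal for i using Rec.prems(2) by (auto simp: trans_less_add1 split: nat.split)
      subgoal for j using Rec.prems(2,3) Y(3,4,5) by (auto split: nat.split)
      subgoal for a using Rec.prems(4) Y(5) by auto
      done
    from Rec.IH(3)[OF c(5) this] obtain Z where
      Z: "reaches P (?q3, Y) (cb i) (?q4, Z)" "Z (reg (t + 3)) = r (Suc i)"
        "\<And>a. a > reg (t + 3) \<Longrightarrow> Z a = Y a" unfolding computes_def r_def cb_def by auto
    define Z' where "Z' = Z(reg (t + 2) := r (Suc i), reg (t + 3) := 1,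
      reg (t + 1) := int i + 1, reg t := eval M v N - int i - 1)"
    have Zt: "Z (reg t) = eval M v N - int i" "Z (reg (t + 1)) = int i"
      using Z(3) Y(2,3) by auto
    have "reaches P (?q4, Z) 6 (?q2, Z')"
      using c(6) Z(2) Zt unfolding Z'_def
      by (auto simp: code_at_Cons eval_nat_numeral fun_eq_iff simp del: of_nat_add
          intro!: reaches_step reaches_eq)
    from reaches_trans[OF Y(1) reaches_trans[OF s reaches_trans[OF Z(1) this]]]
    have "reaches P (?q2, X2) (\<Sum>j<Suc i. 7 + cb j) (?q2, Z')" by (simp add: add_ac)
    moreover have "Z' a = X a" if "a > reg t" for a
      using that Z(3) Y(5) by (simp add: Z'_def)
    moreover have "Z' (reg t) = eval M v N - int i - 1" "Z' (reg (t + 1)) = int i + 1"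
      "Z' (reg (t + 2)) = r (Suc i)" by (simp_all add: Z'_def)
    ultimately show ?case by (intro exI[of _ Z']) (simp del: sum.lessThan_Suc)
  qed
  from loop[of k] obtain Y where Y: "reaches P (?q2, X2) (\<Sum>j<k. 7 + cb j) (?q2, Y)"
    "Y (reg t) \<le> 0" "Y (reg (t + 2)) = r k" "\<And>a. a > reg t \<Longrightarrow> Y a = X a"
    by (auto simp: k_def)
  have "reaches P (?q2, Y) 3 (?q4 + 6, Y(reg (t + 3) := 1))"
    using c(4) Y(2)
    by (auto simp: code_at_Cons eval_nat_numeral fun_eq_iff simp del: of_nat_add
        intro!: reaches_step reaches_eq)
  moreover have "reaches P (?q4 + 6, Y(reg (t + 3) := 1)) 2
      (?q4 + 8, Y(reg (t + 3) := 1, reg t := r k))"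
    using c(7) Y(3)
    by (auto simp: code_at_Cons eval_nat_numeral fun_eq_iff simp del: of_nat_add
        intro!: reaches_step reaches_eq)
  ultimately have e: "reaches P (?q2, Y) 5 (?q4 + 8, Y(reg (t + 3) := 1, reg t := r k))"
    using reaches_trans by fastforce
  from reaches_trans[OF X1(1) reaches_trans[OF s1[folded X1'_def]
      reaches_trans[OF X2(1) reaches_trans[OF Y(1) e]]]]
  show ?case
    unfolding computes_def
    by (intro exI[of _ "Y(reg (t + 3) := 1, reg t := r k)"])
       (auto simp: Y(4) r_def k_def cb_def add_ac eval_nat_numeral elim!: reaches_mono)
qed

definition program :: "ex \<Rightarrow> instr list" where
  "program e = compile e (\<lambda>_. 0) 1 0 @ [Const 0 0, Add 0 0 (reg 1)]"

text \<open>All variables are mapped to \<open>reg 0\<close>, the address -1. It holds 0 in the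
  input, and the compiled expression only writes from \<open>reg 1\<close> downwards, so the initial
  environment is constantly 0. Two more instructions copy the result to register 0.\<close>

lemma program_decides:
  assumes "M (- 1) = 0" and "eval M (\<lambda>_. 0) e = of_bool b"
  shows "ram_decides_within (program e) M b (cost M (\<lambda>_. 0) e + 2)"
proof -
  let ?P = "program e"
  have "?P = [] @ compile e (\<lambda>_. 0) 1 0 @ [Const 0 0, Add 0 0 (reg 1)]"
    by (simp add: program_def)
  then have c: "code_at ?P 0 (compile e (\<lambda>_. 0) 1 0)" unfolding code_at_def by blast
  have "?P = compile e (\<lambda>_. 0) 1 0 @ [Const 0 0, Add 0 0 (reg 1)] @ []"
    by (simp add: program_def)
  then have c': "code_at ?P (code_length e) [Const 0 0, Add 0 0 (reg 1)]" unfolding code_at_def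
    using length_compile by blast
  from compile_correct[OF c, of M "\<lambda>_. 0" M] assms(1) obtain X where
    X: "reaches ?P (0, M) (cost M (\<lambda>_. 0) e) (code_length e, X)" "X (reg 1) = of_bool b"
    unfolding computes_def assms(2) by auto
  have "reaches ?P (code_length e, X) 2 (code_length e + 2, X(0 := of_bool b))"
    using c' X(2) by (auto simp: code_at_Cons eval_nat_numeral intro!: reaches_step reaches_eq)
  from reaches_trans[OF X(1) this] show ?thesis
    unfolding ram_decides_within_def reaches_def by (auto simp: halted_def program_def)
qed

section \<open>Computability with polynomial overhead\<close>

text \<open>The summand 1 keeps the size positive, so that its powers grow with the exponent. On an
  instance the size is \<open>n + 1\<close>.\<close>

definition msize :: "memory \<Rightarrow> nat" where
  "msize M = nat (M 0) + 1"

lemma msize_pos: "0 < msize M"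
  by (simp add: msize_def)

text \<open>The factor \<open>F\<close> is the number of branchings; the remaining cost is polynomial in the number of
  vertices. The domain \<open>A\<close> matters only for the two exponential searches.\<close>

definition realizes ::
    "ex \<Rightarrow> nat \<Rightarrow> nat \<Rightarrow> (memory \<Rightarrow> env \<Rightarrow> bool) \<Rightarrow> (memory \<Rightarrow> nat) \<Rightarrow> (memory \<Rightarrow> env \<Rightarrow> int) \<Rightarrow> bool" where
  "realizes e C k A F f \<longleftrightarrow> (\<forall>M v. A M v \<longrightarrow>
     0 < F M \<and> eval M v e = f M v \<and> cost M v e \<le> C * F M * msize M ^ k)"

definition computable :: "(memory \<Rightarrow> env \<Rightarrow> bool) \<Rightarrow> (memory \<Rightarrow> nat) \<Rightarrow> (memory \<Rightarrow> env \<Rightarrow> int) \<Rightarrow> bool" where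
  "computable A F f \<longleftrightarrow> (\<exists>e C k. realizes e C k A F f)"

abbreviation poly_computable :: "(memory \<Rightarrow> env \<Rightarrow> int) \<Rightarrow> bool" where
  "poly_computable \<equiv> computable (\<lambda>_ _. True) (\<lambda>_. 1)"

lemma compI:
  "(\<And>M v. A M v \<Longrightarrow> 0 < F M \<and> eval M v e = f M v \<and> cost M v e \<le> C * F M * msize M ^ k) \<Longrightarrow>
      computable A F f"
  unfolding computable_def realizes_def by blast

lemma realizesD:
  assumes "realizes e C k A F f" "A M v"
  shows "0 < F M" "eval M v e = f M v" "cost M v e \<le> C * F M * msize M ^ k"
  using assms unfolding realizes_def by auto

lemma computable_mono:
  assumes "computable A F f" "\<And>M v. B M v \<Longrightarrow> A M v" "\<And>M v. B M v \<Longrightarrow> F M \<le> D * G M"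
    "\<And>M v. B M v \<Longrightarrow> 0 < G M" "\<And>M v. B M v \<Longrightarrow> f M v = g M v"
  shows "computable B G g"
proof -
  from assms(1) obtain e C k where "realizes e C k A F f"
    unfolding computable_def by blast
  note e = realizesD[OF this]
  show ?thesis
  proof (rule compI[where e = e and C = "C * D" and k = k])
    fix M v assume B: "B M v"
    have "cost M v e \<le> C * F M * msize M ^ k" using e(3) assms(2) B by blast
    also have "\<dots> \<le> C * (D * G M) * msize M ^ k" using assms(3)[OF B] by (intro mult_mono) auto
    finally show "0 < G M \<and> eval M v e = g M v \<and> cost M v e \<le> C * D * G M * msize M ^ k"
      using e(2) assms(2,4,5) B by (auto simp: mult.assoc)
  qed
qed

text \<open>Exponents are added instead of taking their maximum: as the base and \<open>F\<close>
  are positive, every summand, the constant included, lies below its own coefficient times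
  \<open>F * s ^ (k + k')\<close>.\<close>

lemma cost_add:
  fixes x y C F s k C' k' c :: nat
  assumes "x \<le> C * F * s ^ k" "y \<le> C' * F * s ^ k'" "0 < F" "0 < s"
  shows "x + y + c \<le> (C + C' + c) * F * s ^ (k + k')"
proof -
  define p where "p = s ^ (k + k')"
  have "s ^ k \<le> p" "s ^ k' \<le> p" unfolding p_def using assms(4) by (auto intro: power_increasing)
  then have "x \<le> C * F * p" "y \<le> C' * F * p"
    using assms(1,2) by (meson mult_le_mono2 order_trans)+
  moreover have "0 < F * p" unfolding p_def using assms(3,4) by simp
  then have "c * 1 \<le> c * (F * p)" by (intro mult_le_mono2) simp
  ultimately have "x + y + c \<le> C * F * p + C' * F * p + c * (F * p)" by linarith
  then show ?thesis unfolding p_def by (simp add: algebra_simps)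
qed

section \<open>Closure under the constructs of the language\<close>

lemma computable_num: "poly_computable (\<lambda>M v. c)"
  by (rule compI[where e = "Num c" and C = 1 and k = 0]) auto

lemma computable_var: "poly_computable (\<lambda>M v. v i)"
  by (rule compI[where e = "Var i" and C = 2 and k = 0]) auto

text \<open>Weakening and exchange of variables. They are free of charge, since \<open>Ren\<close>
  only changes the map from variables to registers at compile time.\<close>

lemma computable_ren:
  assumes "computable A F f"
  shows "computable (\<lambda>M v. A M (\<lambda>i. v (r i))) F (\<lambda>M v. f M (\<lambda>i. v (r i)))"
proof -
  from assms obtain e C k where "realizes e C k A F f"
    unfolding computable_def by blast
  note e = realizesD[OF this]
  show ?thesis by (rule compI[where e = "Ren r e" and C = C and k = k]) (auto simp: e)
qed

lemma computable_plus:
  assumes "computable A F f" "computable A F g"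
  shows "computable A F (\<lambda>M v. f M v + g M v)"
proof -
  from assms(1) obtain e C k where "realizes e C k A F f"
    unfolding computable_def by blast
  note e = realizesD[OF this]
  from assms(2) obtain e' C' k' where "realizes e' C' k' A F g"
    unfolding computable_def by blast
  note e' = realizesD[OF this]
  show ?thesis
    using cost_add[OF e(3) e'(3) e(1) msize_pos, where c = 1]
    by (intro compI[where e = "Plus e e'" and C = "C + C' + 1" and k = "k + k'"]) (auto simp: e e')
qed

lemma computable_minus:
  assumes "computable A F f" "computable A F g"
  shows "computable A F (\<lambda>M v. f M v - g M v)"
proof -
  from assms(1) obtain e C k where "realizes e C k A F f"
    unfolding computable_def by blast
  note e = realizesD[OF this]
  from assms(2) obtain e' C' k' where "realizes e' C' k' A F g"
    unfolding computable_def by blast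
  note e' = realizesD[OF this]
  show ?thesis
    using cost_add[OF e(3) e'(3) e(1) msize_pos, where c = 1]
    by (intro compI[where e = "Minus e e'" and C = "C + C' + 1" and k = "k + k'"]) (auto simp: e e')
qed

lemma computable_read:
  assumes "computable A F f"
  shows "computable A F (\<lambda>M v. M (max 0 (f M v)))"
proof -
  from assms(1) obtain e C k where "realizes e C k A F f"
    unfolding computable_def by blast
  note e = realizesD[OF this]
  show ?thesis
    using cost_add[OF e(3) _ e(1) msize_pos, where c = 5 and y = 0 and C' = 0 and k' = 0]
    by (intro compI[where e = "Read e" and C = "C + 5" and k = "k"]) (auto simp: e)
qed

text \<open>A branch has to meet its cost bound only where it is taken. This makes lazy evaluation
  visible in the bounds, and the searches depend on it.\<close>

lemma computable_cond:
  assumes "computable A F c" "computable (\<lambda>M v. A M v \<and> c M v > 0) F f"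
      "computable (\<lambda>M v. A M v \<and> c M v \<le> 0) F g"
  shows "computable A F (\<lambda>M v. if c M v > 0 then f M v else g M v)"
proof -
  from assms(1) obtain e C k where "realizes e C k A F c"
    unfolding computable_def by blast
  note e = realizesD[OF this]
  from assms(2) obtain e1 C1 k1 where "realizes e1 C1 k1 (\<lambda>M v. A M v \<and> c M v > 0) F f"
    unfolding computable_def by blast
  note e1 = realizesD[OF this]
  from assms(3) obtain e2 C2 k2 where "realizes e2 C2 k2 (\<lambda>M v. A M v \<and> c M v \<le> 0) F g"
    unfolding computable_def by blast
  note e2 = realizesD[OF this]
  show ?thesis
  proof (rule compI[where e = "Cond e e1 e2" and C = "C + (C1 + C2) + 3" and k = "k + (k1 + k2)"])
    fix M v assume A: "A M v"
    have "(if c M v > 0 then cost M v e1 else cost M v e2) \<le> (C1 + C2) * F M * msize M ^ (k1 + k2)"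
    proof (cases "c M v > 0")
      case True
      then show ?thesis
        using cost_add[OF e1(3)[of M v] _ e(1)[OF A] msize_pos, where c = 0 and y = 0 and C' =
            C2 and k' = k2] A
        by auto
    next
      case False
      then show ?thesis
        using cost_add[OF _ e2(3)[of M v] e(1)[OF A] msize_pos, where c = 0 and x = 0 and C =
            C1 and k = k1] A
        by auto
    qed
    from cost_add[OF e(3)[OF A] this e(1)[OF A] msize_pos, where c = 3]
    show "0 < F M \<and> eval M v (Cond e e1 e2) = (if c M v > 0 then f M v else g M v) \<and>
        cost M v (Cond e e1 e2) \<le> (C + (C1 + C2) + 3) * F M * msize M ^ (k + (k1 + k2))"
      using A e(1,2) e1(2) e2(2) by auto
  qed
qed

lemma computable_bind:
  assumes "computable A F g" "computable B F (\<lambda>M v. f M (\<lambda>j. v (Suc j)) (v 0))"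
    and "\<And>M v. A M v \<Longrightarrow> B M (push (g M v) v)"
  shows "computable A F (\<lambda>M v. f M v (g M v))"
proof -
  from assms(1) obtain e C k where "realizes e C k A F g"
    unfolding computable_def by blast
  note e = realizesD[OF this]
  from assms(2) obtain e' C' k' where "realizes e' C' k' B F (\<lambda>M v. f M (\<lambda>j. v (Suc j)) (v 0))"
    unfolding computable_def by blast
  note e' = realizesD[OF this]
  show ?thesis
    using cost_add[OF e(3) e'(3) e(1) msize_pos, where c = 2] assms(3)
    by (intro compI[where e = "Bind e e'" and C = "C + C' + 2" and k = "k + k'"]) (auto simp: e e')
qed

text \<open>The rounds contribute the factor \<open>FN\<close> and the body the factor
  \<open>FB\<close>: exponentially many rounds go with a polynomial body, and polynomially many
  rounds leave room for an exponential body. The body has to behave only on the environments that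
  occur in the run, which \<open>B\<close> describes.\<close>

lemma computable_recur:
  assumes N: "computable A F N" and a: "computable A F a"
    and b: "computable B FB (\<lambda>M v. b M (\<lambda>j. v (Suc (Suc j))) (v 0) (v (Suc 0)))"
    and bound: "\<And>M v. A M v \<Longrightarrow> nat (N M v) \<le> D * FN M * msize M ^ m"
    and F: "\<And>M v. A M v \<Longrightarrow> FN M * FB M \<le> F M"
    and inv: "\<And>M v i. A M v \<Longrightarrow> i < nat (N M v) \<Longrightarrow> B M (push (int i) (push (recur (b M v) (a M v) i) v))"
  shows "computable A F (\<lambda>M v. recur (b M v) (a M v) (nat (N M v)))"
proof -
  from N obtain eN CN kN where "realizes eN CN kN A F N"
    unfolding computable_def by blast
  note eN = realizesD[OF this]
  from a obtain ea Ca ka where "realizes ea Ca ka A F a"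
    unfolding computable_def by blast
  note ea = realizesD[OF this]
  from b obtain eb Cb kb where "realizes eb Cb kb B FB (\<lambda>M v. b M (\<lambda>j. v (Suc (Suc j))) (v 0)
      (v (Suc 0)))"
    unfolding computable_def by blast
  note eb = realizesD[OF this]
  let ?r = "\<lambda>M v. recur (\<lambda>i x. eval M (push i (push x v)) eb) (a M v)"
  have r: "?r M v i = recur (b M v) (a M v) i" if "A M v" "i \<le> nat (N M v)" for M v i
    using that(2)
  proof (induction i)
    case (Suc i)
    then show ?case using eb(2)[OF inv[OF that(1), of i]] by simp
  qed auto
  show ?thesis
  proof (rule compI[where e = "Rec eN ea eb" and k = "kN + ka + (m + kb)"
        and C = "CN + Ca + 6 + D * (7 + Cb) + 0"])
    fix M v assume A: "A M v"
    let ?c = "\<lambda>i. cost M (push (int i) (push (?r M v i) v)) eb"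
    have c: "7 + ?c i \<le> (7 + Cb) * FB M * msize M ^ kb" if i: "i < nat (N M v)" for i
    proof -
      have B: "B M (push (int i) (push (?r M v i) v))" using inv[OF A i] r[OF A, of i] i by simp
      from cost_add[OF eb(3)[OF B] _ eb(1)[OF B] msize_pos, where c = 7 and y = 0 and C' =
          0 and k' = 0]
      show ?thesis by (simp add: add.commute)
    qed
    have "(\<Sum>i<nat (N M v). 7 + ?c i) \<le> nat (N M v) * ((7 + Cb) * FB M * msize M ^ kb)"
      using sum_bounded_above[of "{..<nat (N M v)}" "\<lambda>i. 7 + ?c i"] c by simp
    also have "\<dots> \<le> (D * FN M * msize M ^ m) * ((7 + Cb) * FB M * msize M ^ kb)"
      using bound[OF A] by (rule mult_right_mono) simp
    also have "\<dots> = D * (7 + Cb) * (FN M * FB M) * msize M ^ (m + kb)"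
      by (simp add: power_add mult_ac)
    also have "\<dots> \<le> D * (7 + Cb) * F M * msize M ^ (m + kb)"
      using F[OF A] by (intro mult_right_mono mult_left_mono) auto
    finally have s: "(\<Sum>i<nat (N M v). 7 + ?c i) \<le> D * (7 + Cb) * F M * msize M ^ (m + kb)" .
    from cost_add[OF cost_add[OF eN(3) ea(3) eN(1) msize_pos, OF A A A, where c = 6]
        s eN(1)[OF A] msize_pos,
        where c = 0]
    show "0 < F M \<and> eval M v (Rec eN ea eb) = recur (b M v) (a M v) (nat (N M v)) \<and>
       cost M v (Rec eN ea eb) \<le> (CN + Ca + 6 + D * (7 + Cb) + 0)
           * F M * msize M ^ (kN + ka + (m + kb))"
      using A eN ea(2) r[OF A] by simp
  qed
qed

text \<open>The first hit, or -1. The tests have the shape of \<open>Cond\<close>: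
  \<open>a + 1 > 0\<close> says that a hit is stored already, and then \<open>P\<close> is not
  evaluated any more, although the loop runs on.\<close>

definition search :: "(int \<Rightarrow> bool) \<Rightarrow> int \<Rightarrow> int" where
  "search P N = recur (\<lambda>i a. if a + 1 > 0 then a else if of_bool (P i) > (0::int)
      then i else - 1) (- 1) (nat N)"

lemma search_cases:
  obtains "search P N = - 1" "\<forall>i\<in>{0..<N}. \<not> P i"
  | "search P N \<in> {0..<N}" "P (search P N)" "\<forall>j\<in>{0..<search P N}. \<not> P j"
proof -
  let ?s = "recur (\<lambda>i a. if a + 1 > 0 then a else if of_bool (P i) > (0::int) then i else - 1) (- 1)"
  have "?s k = - 1 \<and> (\<forall>i\<in>{0..<int k}. \<not> P i) \<or>
      ?s k \<in> {0..<int k} \<and> P (?s k) \<and> (\<forall>j\<in>{0..<?s k}. \<not> P j)" for k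
  proof (induction k)
    case (Suc k)
    have "{0..<int (Suc k)} = insert (int k) {0..<int k}" by auto
    then show ?case using Suc by auto
  qed auto
  from this[of "nat N"] show ?thesis
    using that unfolding search_def by (cases "N \<ge> 0") auto
qed

lemma search_ge_0_iff: "search P N \<ge> 0 \<longleftrightarrow> (\<exists>i\<in>{0..<N}. P i)"
  by (rule search_cases[of P N]) auto

lemma search_neg_iff: "search P N < 0 \<longleftrightarrow> (\<forall>i\<in>{0..<N}. \<not> P i)"
  using search_ge_0_iff[of P N] by (auto simp: not_le[symmetric])

lemma search_less: "0 \<le> search P N \<Longrightarrow> search P N < N"
  by (rule search_cases[of P N]) simp_all

lemma search_witness:
  assumes "i \<in> {0..<N}" "P i"
  shows "search P N \<in> {0..<N}" "P (search P N)"
  by (rule search_cases[of P N]; use assms in auto)+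

lemma search_le:
  assumes "i \<in> {0..<N}" "P i"
  shows "search P N \<le> i"
proof (rule search_cases[of P N])
  assume "\<forall>j\<in>{0..<search P N}. \<not> P j"
  then show ?thesis using assms by (meson atLeastLessThan_iff not_le)
qed (use assms in auto)

lemma computable_const: "(\<And>M v. A M v \<Longrightarrow> 0 < F M) \<Longrightarrow> poly_computable f \<Longrightarrow> computable A F f"
  by (rule computable_mono[where A = "\<lambda>_ _. True" and F = "\<lambda>_. 1" and D = 1]) (auto simp: Suc_le_eq)

text \<open>The predicate is charged only at indices below which there is no hit. If its cost grows
  with the index, the bound \<open>FB\<close> therefore has to hold only up to the first
  hit.\<close>

lemma computable_search:
  assumes N: "computable A F N"
    and P: "computable (\<lambda>M v. A M (\<lambda>j. v (Suc j)) \<and> 0 \<le> v 0 \<and> v 0 < N M (\<lambda>j. v (Suc j)) \<and>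
        (\<forall>i\<in>{0..<v 0}. \<not> P M (\<lambda>j. v (Suc j)) i)) FB (\<lambda>M v. of_bool (P M (\<lambda>j. v (Suc j)) (v 0)))"
    and FB: "\<And>M v. A M v \<Longrightarrow> 0 < FB M"
    and bound: "\<And>M v. A M v \<Longrightarrow> nat (N M v) \<le> D * FN M * msize M ^ m"
    and F: "\<And>M v. A M v \<Longrightarrow> FN M * FB M \<le> F M"
  shows "computable A F (\<lambda>M v. search (P M v) (N M v))"
proof -
  have FA: "0 < F M" if "A M v" for M v using N that by (auto simp: computable_def dest: realizesD(1))
  define B where "B M v \<longleftrightarrow> A M (\<lambda>j. v (Suc (Suc j))) \<and> 0 \<le> v 0 \<and> v 0 < N M (\<lambda>j. v (Suc (Suc j))) \<and>
      v (Suc 0) = search (P M (\<lambda>j. v (Suc (Suc j)))) (v 0)" for M and v :: env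
  define P' where "P' M v = (of_bool (P M (\<lambda>j. v (Suc (Suc j))) (v 0)) :: int)" for M and v :: env
  have BF: "0 < FB M" if "B M v" for M v using FB that by (auto simp: B_def)
  have P': "computable (\<lambda>M v. B M v \<and> v (Suc 0) + 1 \<le> 0) FB P'"
    unfolding P'_def
  \<comment> \<open>The loop body has the accumulator at index 1, where the predicate expects its
    own first variable; the renaming skips it. A negative accumulator means that no earlier index
    was a hit, which is the domain in the hypothesis on \<open>P\<close>.\<close>
  proof (rule computable_mono[OF computable_ren[OF P, of "\<lambda>j. if j =
      0 then 0 else Suc j"], where D = 1], goal_cases)
    case (1 M v)
    then show ?case
      by (auto simp: B_def split: if_splits) (rule search_cases[of "P M (\<lambda>j. v (Suc (Suc j)))"
          "v 0"]; auto)
  qed (auto simp: BF)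
  have c: "computable B' FB f" if "poly_computable f" "\<And>M v. B' M v \<Longrightarrow> B M v" for B' f
    by (rule computable_const) (use that BF in auto)
  have "computable A F (\<lambda>M v. recur (\<lambda>i a. if a + 1 > 0 then a else if of_bool (P M v i)
      > (0::int) then i else - 1)
      (- 1) (nat (N M v)))"
  proof (rule computable_recur[where B = B and FN = FN and FB = FB, OF N _ _ bound F])
    show "computable A F (\<lambda>M v. - 1)" by (rule computable_const[OF FA computable_num])
    show "computable B FB (\<lambda>M v. if v (Suc 0) + 1 > 0 then v (Suc 0)
        else if 0 < (of_bool (P M (\<lambda>j. v (Suc (Suc j))) (v 0)) :: int) then v 0 else - 1)"
      unfolding P'_def[symmetric]
      by (rule computable_cond[OF c[OF computable_plus[OF computable_var computable_num]]
          c[OF computable_var]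
            computable_cond[OF P' c[OF computable_var] c[OF computable_num]]]) auto
    show "B M (push (int i) (push (recur (\<lambda>i a. if a + 1 > 0 then a else if of_bool (P M v i)
        > (0::int) then i else - 1)
      (- 1) i) v))" if "A M v" "i < nat (N M v)" for M v i
      using that by (auto simp: B_def search_def)
  qed auto
  then show ?thesis unfolding search_def .
qed

section \<open>Functions and predicates of polynomial cost\<close>

named_theorems poly_intros

lemmas [poly_intros] = computable_num computable_var

lemma poly_add [poly_intros]: "poly_computable f \<Longrightarrow> poly_computable g \<Longrightarrow>
    poly_computable (\<lambda>M v. f M v + g M v)"
  by (rule computable_plus)

lemma poly_diff [poly_intros]: "poly_computable f \<Longrightarrow> poly_computable g \<Longrightarrow>
    poly_computable (\<lambda>M v. f M v - g M v)"
  by (rule computable_minus)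

lemma poly_size [poly_intros]: "poly_computable (\<lambda>M v. M 0)"
  using computable_read[OF computable_num[of 0]] by simp

lemma poly_read: "poly_computable f \<Longrightarrow> poly_computable (\<lambda>M v. M (max 0 (f M v)))"
  by (rule computable_read)

abbreviation poly_decidable :: "(memory \<Rightarrow> env \<Rightarrow> bool) \<Rightarrow> bool" where
  "poly_decidable P \<equiv> poly_computable (\<lambda>M v. of_bool (P M v))"

lemma poly_weaken: "poly_computable f \<Longrightarrow> computable A (\<lambda>_. 1) f"
  by (rule computable_const) auto

lemma poly_cong:
  assumes "poly_computable f" "\<And>M v. f M v = g M v" shows "poly_computable g"
proof -
  have "f = g" using assms(2) by (intro ext)
  then show ?thesis using assms(1) by simp
qed

lemma poly_if:
  assumes "poly_decidable P" "poly_computable f" "poly_computable g"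
  shows "poly_computable (\<lambda>M v. if P M v then f M v else g M v)"
proof -
  have "poly_computable (\<lambda>M v. if of_bool (P M v) > (0::int) then f M v else g M v)"
    by (rule computable_cond[OF assms(1) poly_weaken[OF assms(2)] poly_weaken[OF assms(3)]])
  then show ?thesis by (rule poly_cong) simp
qed

lemma poly_less [poly_intros]:
  assumes "poly_computable f" "poly_computable g"
  shows "poly_decidable (\<lambda>M v. f M v < g M v)"
proof -
  have "poly_computable (\<lambda>M v. if g M v - f M v > 0 then 1 else 0)"
    by (rule computable_cond[OF computable_minus[OF assms(2,1)] poly_weaken[OF computable_num]
        poly_weaken[OF computable_num]])
  then show ?thesis by (rule poly_cong) simp
qed

lemma poly_not [poly_intros]: "poly_decidable P \<Longrightarrow> poly_decidable (\<lambda>M v. \<not> P M v)"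
  by (rule poly_cong[OF computable_minus[OF computable_num[of 1]]]) auto

lemma poly_conj [poly_intros]:
  assumes "poly_decidable P" "poly_decidable Q" shows "poly_decidable (\<lambda>M v. P M v \<and> Q M v)"
proof -
  have "poly_computable (\<lambda>M v. if P M v then of_bool (Q M v) else 0)"
    by (rule poly_if[OF assms computable_num])
  then show ?thesis by (rule poly_cong) simp
qed

lemma poly_disj [poly_intros]: "poly_decidable P \<Longrightarrow> poly_decidable Q \<Longrightarrow>
    poly_decidable (\<lambda>M v. P M v \<or> Q M v)"
  by (rule poly_cong[OF poly_not[OF poly_conj[OF poly_not poly_not]]]) auto

lemma poly_imp [poly_intros]: "poly_decidable P \<Longrightarrow> poly_decidable Q \<Longrightarrow>
    poly_decidable (\<lambda>M v. P M v \<longrightarrow> Q M v)"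
  by (rule poly_cong[OF poly_disj[OF poly_not]]) auto

lemma poly_le [poly_intros]: "poly_computable f \<Longrightarrow> poly_computable g \<Longrightarrow>
    poly_decidable (\<lambda>M v. f M v \<le> g M v)"
  by (rule poly_cong[OF poly_not[OF poly_less, of g f]]) auto

lemma poly_eq [poly_intros]: "poly_computable f \<Longrightarrow> poly_computable g \<Longrightarrow>
    poly_decidable (\<lambda>M v. f M v = g M v)"
  by (rule poly_cong[OF poly_conj[OF poly_le poly_le, of f g g f]]) auto

lemma poly_min [poly_intros]: "poly_computable f \<Longrightarrow> poly_computable g \<Longrightarrow>
    poly_computable (\<lambda>M v. min (f M v) (g M v))"
  unfolding min_def by (rule poly_if[OF poly_le])

lemma poly_recur:
  assumes "poly_computable N" "poly_computable a" "\<And>M v. nat (N M v) \<le> 3 * msize M"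
    "poly_computable (\<lambda>M v. b M (\<lambda>j. v (Suc (Suc j))) (v 0) (v (Suc 0)))"
  shows "poly_computable (\<lambda>M v. recur (b M v) (a M v) (nat (N M v)))"
  by (rule computable_recur[where FN = "\<lambda>_. 1" and FB = "\<lambda>_. 1" and D = 3 and m = 1, OF assms(1,2,4)])
     (use assms(3) in auto)

lemma poly_search:
  assumes "poly_computable N" "\<And>M v. nat (N M v) \<le> 3 * msize M"
      "poly_decidable (\<lambda>M v. P M (\<lambda>j. v (Suc j)) (v 0))"
  shows "poly_computable (\<lambda>M v. search (P M v) (N M v))"
  by (rule computable_search[where FN = "\<lambda>_. 1" and FB = "\<lambda>_. 1" and D = 3 and m = 1,
        OF assms(1) poly_weaken[OF assms(3)]])
     (use assms(2) in auto)

lemma poly_bex: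
  assumes "poly_computable N" "\<And>M v. nat (N M v) \<le> 3 * msize M"
      "poly_decidable (\<lambda>M v. P M (\<lambda>j. v (Suc j)) (v 0))"
  shows "poly_decidable (\<lambda>M v. \<exists>i\<in>{0..<N M v}. P M v i)"
  unfolding search_ge_0_iff[symmetric] by (rule poly_le[OF computable_num poly_search[OF assms]])

lemma poly_ball:
  assumes "poly_computable N" "\<And>M v. nat (N M v) \<le> 3 * msize M"
      "poly_decidable (\<lambda>M v. P M (\<lambda>j. v (Suc j)) (v 0))"
  shows "poly_decidable (\<lambda>M v. \<forall>i\<in>{0..<N M v}. P M v i)"
  by (rule poly_cong[OF poly_not[OF poly_bex[OF assms(1,2) poly_not[OF assms(3)]]]]) auto

lemma sum_eq_recur: "(\<Sum>i\<in>{0..<N}. f i) = recur (\<lambda>i a. a + f i) 0 (nat N)" for N :: int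
proof -
  have "(\<Sum>i\<in>{0..<int k}. f i) = recur (\<lambda>i a. a + f i) 0 k" for k
  proof (induction k)
    case (Suc k)
    have "{0..<int (Suc k)} = insert (int k) {0..<int k}" by auto
    then show ?case using Suc by simp
  qed simp
  from this[of "nat N"] show ?thesis by (cases "N \<ge> 0") auto
qed

lemma poly_sum:
  assumes "poly_computable N" "\<And>M v. nat (N M v) \<le> 3 * msize M"
      "poly_computable (\<lambda>M v. f M (\<lambda>j. v (Suc j)) (v 0))"
  shows "poly_computable (\<lambda>M v. \<Sum>i\<in>{0..<N M v}. f M v i)"
  unfolding sum_eq_recur
proof (rule poly_recur[OF assms(1) computable_num assms(2)])
  show "poly_computable (\<lambda>M v. v (Suc 0) + f M (\<lambda>j. v (Suc (Suc j))) (v 0))"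
    using computable_ren[OF assms(3), of "\<lambda>j. if j = 0 then 0 else Suc j"]
    by (intro poly_add computable_var) simp
qed

lemma poly_let:
  assumes "poly_computable g" "poly_computable (\<lambda>M v. f M (\<lambda>j. v (Suc j)) (v 0))"
  shows "poly_computable (\<lambda>M v. let x = g M v in f M v x)"
  unfolding Let_def by (rule computable_bind[OF assms]) simp

text \<open>This and its versions for more arguments reduce composition to arguments that are
  variables, so each function defined below is checked once, by unfolding it. The last argument is
  bound first, which puts the first one at index 0.\<close>

lemma poly_subst1:
  assumes "poly_computable (\<lambda>M v. h M (v 0))" "poly_computable a"
  shows "poly_computable (\<lambda>M v. h M (a M v))"
  by (rule computable_bind[OF assms(2), where f = "\<lambda>M v x. h M x"]) (use assms in auto)

lemma poly_subst2:
  assumes "poly_computable (\<lambda>M v. h M (v 0) (v (Suc 0)))" "poly_computable a" "poly_computable b"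
  shows "poly_computable (\<lambda>M v. h M (a M v) (b M v))"
proof (rule computable_bind[OF assms(3), where f = "\<lambda>M v x. h M (a M v) x"])
  show "poly_computable (\<lambda>M v. h M (a M (\<lambda>j. v (Suc j))) (v 0))"
    by (rule computable_bind[OF computable_ren[OF assms(2), of Suc], where f = "\<lambda>M v x. h M x (v 0)"])
       (use assms in auto)
qed simp

lemma poly_subst3:
  assumes "poly_computable (\<lambda>M v. h M (v 0) (v (Suc 0)) (v (Suc (Suc 0))))" "poly_computable a"
      "poly_computable b" "poly_computable c"
  shows "poly_computable (\<lambda>M v. h M (a M v) (b M v) (c M v))"
proof (rule computable_bind[OF assms(4), where f = "\<lambda>M v x. h M (a M v) (b M v) x"])
  show "poly_computable (\<lambda>M v. h M (a M (\<lambda>j. v (Suc j))) (b M (\<lambda>j. v (Suc j))) (v 0))"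
  proof (rule computable_bind[OF computable_ren[OF assms(3), of Suc], where f =
      "\<lambda>M v x. h M (a M (\<lambda>j. v (Suc j))) x (v 0)"])
    show "poly_computable (\<lambda>M v. h M (a M (\<lambda>j. v (Suc (Suc j)))) (v 0) (v (Suc 0)))"
      by (rule computable_bind[OF computable_ren[OF assms(2), of "\<lambda>j. Suc (Suc j)"], where f =
          "\<lambda>M v x. h M x (v 0) (v (Suc 0))"])
         (use assms in auto)
  qed simp
qed simp

lemma poly_subst4:
  assumes "poly_computable (\<lambda>M v. h M (v 0) (v (Suc 0)) (v (Suc (Suc 0))) (v (Suc (Suc (Suc 0)))))"
    "poly_computable a" "poly_computable b" "poly_computable c" "poly_computable d"
  shows "poly_computable (\<lambda>M v. h M (a M v) (b M v) (c M v) (d M v))"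
proof (rule computable_bind[OF assms(5), where f = "\<lambda>M v x. h M (a M v) (b M v) (c M v) x"])
  let ?h = "\<lambda>M v x y z. h M x y z (v 0)"
  show "poly_computable (\<lambda>M v. h M (a M (\<lambda>j. v (Suc j))) (b M (\<lambda>j. v (Suc j)))
      (c M (\<lambda>j. v (Suc j))) (v 0))"
  proof (rule computable_bind[OF computable_ren[OF assms(4), of Suc],
        where f = "\<lambda>M v x. h M (a M (\<lambda>j. v (Suc j))) (b M (\<lambda>j. v (Suc j))) x (v 0)"])
    let ?s = "\<lambda>v j. v (Suc (Suc j)) :: int"
    show "poly_computable (\<lambda>M v. h M (a M (?s v)) (b M (?s v)) (v 0) (v (Suc 0)))"
    proof (rule computable_bind[OF computable_ren[OF assms(3), of "\<lambda>j. Suc (Suc j)"],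
          where f = "\<lambda>M v x. h M (a M (?s v)) x (v 0) (v (Suc 0))"])
      show "poly_computable (\<lambda>M v. h M (a M (\<lambda>j. v (Suc (Suc (Suc j))))) (v 0) (v (Suc 0))
          (v (Suc (Suc 0))))"
        by (rule computable_bind[OF computable_ren[OF assms(2), of "\<lambda>j. Suc (Suc (Suc j))"],
              where f = "\<lambda>M v x. h M x (v 0) (v (Suc 0)) (v (Suc (Suc 0)))"])
           (use assms(1) in auto)
    qed simp
  qed simp
qed simp

lemma poly_subst5:
  assumes "poly_computable (\<lambda>M v. h M (v 0) (v (Suc 0)) (v (Suc (Suc 0))) (v (Suc (Suc (Suc 0))))
      (v (Suc (Suc (Suc (Suc 0))))))"
    "poly_computable a" "poly_computable b" "poly_computable c" "poly_computable d"
        "poly_computable e"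
  shows "poly_computable (\<lambda>M v. h M (a M v) (b M v) (c M v) (d M v) (e M v))"
proof (rule computable_bind[OF assms(6), where f = "\<lambda>M v x. h M (a M v) (b M v) (c M v) (d M v) x"])
  let ?s = "\<lambda>v j. v (Suc j) :: int"
  show "poly_computable (\<lambda>M v. h M (a M (?s v)) (b M (?s v)) (c M (?s v)) (d M (?s v)) (v 0))"
  proof (rule computable_bind[OF computable_ren[OF assms(5), of Suc],
        where f = "\<lambda>M v x. h M (a M (?s v)) (b M (?s v)) (c M (?s v)) x (v 0)"])
    let ?s = "\<lambda>v j. v (Suc (Suc j)) :: int"
    show "poly_computable (\<lambda>M v. h M (a M (?s v)) (b M (?s v)) (c M (?s v)) (v 0) (v (Suc 0)))"
    proof (rule computable_bind[OF computable_ren[OF assms(4), of "\<lambda>j. Suc (Suc j)"],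
          where f = "\<lambda>M v x. h M (a M (?s v)) (b M (?s v)) x (v 0) (v (Suc 0))"])
      let ?s = "\<lambda>v j. v (Suc (Suc (Suc j))) :: int"
      show "poly_computable (\<lambda>M v. h M (a M (?s v)) (b M (?s v)) (v 0) (v (Suc 0)) (v (Suc (Suc 0))))"
      proof (rule computable_bind[OF computable_ren[OF assms(3), of "\<lambda>j. Suc (Suc (Suc j))"],
            where f = "\<lambda>M v x. h M (a M (?s v)) x (v 0) (v (Suc 0)) (v (Suc (Suc 0)))"])
        let ?s = "\<lambda>v j. v (Suc (Suc (Suc (Suc j)))) :: int"
        show "poly_computable (\<lambda>M v. h M (a M (?s v)) (v 0) (v (Suc 0)) (v (Suc (Suc 0)))
            (v (Suc (Suc (Suc 0)))))"
          by (rule computable_bind[OF computable_ren[OF assms(2), of "\<lambda>j. Suc (Suc (Suc (Suc j)))"],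
                where f = "\<lambda>M v x. h M x (v 0) (v (Suc 0)) (v (Suc (Suc 0)))
                    (v (Suc (Suc (Suc 0))))"])
             (use assms(1) in auto)
      qed simp
    qed simp
  qed simp
qed simp

section \<open>Arithmetic and digits\<close>

text \<open>For nonnegative \<open>M 0\<close>, the clamp \<open>2 * M 0 + 3\<close> is no smaller
  than the bases in use, namely 2, 3 and \<open>2 * d\<close> with \<open>d \<le> M 0\<close>; it is
  at most three times the size.\<close>

lemma loop_bounds [poly_intros]:
  "nat (M 0) \<le> 3 * msize M" "nat (M 0 + 1) \<le> 3 * msize M" "nat (min x (2 * M 0 + 3)) \<le> 3 * msize M"
  by (auto simp: msize_def)

lemmas [poly_intros] = poly_if poly_recur poly_search poly_bex poly_ball poly_sum poly_let poly_read

lemma poly_double [poly_intros]: "poly_computable f \<Longrightarrow> poly_computable (\<lambda>M v. 2 * f M v)"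
  by (rule poly_cong[OF poly_add]) auto

lemma int_div_less_iff:
  fixes a b k :: int
  assumes "0 < b"
  shows "a div b < k \<longleftrightarrow> a < b * k"
proof
  assume "a div b < k"
  then have "b * (a div b + 1) \<le> b * k" using assms by (intro mult_left_mono) auto
  moreover have "a mod b < b" using assms by simp
  moreover have "a = b * (a div b) + a mod b" by simp
  moreover have "b * (a div b + 1) = b * (a div b) + b" by (simp add: distrib_left)
  ultimately show "a < b * k" by linarith
next
  assume "a < b * k"
  moreover have "b * (a div b) \<le> a" using assms mult_div_mod_eq[of b a] pos_mod_sign[of b a]
      by linarith
  ultimately have "b * (a div b) < b * k" by linarith
  then show "a div b < k" using assms by simp
qed

text \<open>Sets and labellings are coded as integers in positional notation. Loop bounds are clamped to
  \<open>2 * M 0 + 3\<close>, so that the running time is polynomial whatever the arguments are.\<close>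

definition mul :: "memory \<Rightarrow> int \<Rightarrow> int \<Rightarrow> int" where
  "mul M a b = (\<Sum>i\<in>{0..<min b (2 * M 0 + 3)}. a)"

lemma poly_mul [poly_intros]: "poly_computable a \<Longrightarrow> poly_computable b \<Longrightarrow>
    poly_computable (\<lambda>M v. mul M (a M v) (b M v))"
  by (rule poly_subst2[where h = mul]) (unfold mul_def, intro poly_intros)

lemma mul_eq: "0 \<le> b \<Longrightarrow> b \<le> 2 * M 0 + 3 \<Longrightarrow> mul M a b = a * b"
  by (simp add: mul_def min_def)

definition pow :: "memory \<Rightarrow> int \<Rightarrow> int \<Rightarrow> int" where
  "pow M b j = recur (\<lambda>_ x. mul M x b) 1 (nat (min j (2 * M 0 + 3)))"

lemma poly_pow [poly_intros]: "poly_computable a \<Longrightarrow> poly_computable b \<Longrightarrow>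
    poly_computable (\<lambda>M v. pow M (a M v) (b M v))"
  by (rule poly_subst2[where h = pow]) (unfold pow_def, intro poly_intros)

lemma pow_eq:
  assumes "0 \<le> b" "b \<le> 2 * M 0 + 3" "j \<le> 2 * M 0 + 3"
  shows "pow M b j = b ^ nat j"
proof -
  have "recur (\<lambda>_ x. mul M x b) 1 k = b ^ k" for k
    by (induction k) (use assms in \<open>auto simp: mul_eq\<close>)
  then show ?thesis using assms by (simp add: pow_def min_def)
qed

definition small_mod :: "memory \<Rightarrow> int \<Rightarrow> int \<Rightarrow> int \<Rightarrow> int" where
  "small_mod M B D r = recur (\<lambda>_ x. if D \<le> x then x - D else x) r (nat (min B (2 * M 0 + 3)))"

lemma poly_small_mod [poly_intros]:
  "poly_computable a \<Longrightarrow> poly_computable b \<Longrightarrow> poly_computable c \<Longrightarrow>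
      poly_computable (\<lambda>M v. small_mod M (a M v) (b M v) (c M v))"
  by (rule poly_subst3[where h = small_mod]) (unfold small_mod_def, intro poly_intros)

lemma small_mod_eq:
  assumes "0 \<le> B" "B \<le> 2 * M 0 + 3" "0 < D" "0 \<le> r" "r < B * D"
  shows "small_mod M B D r = r mod D"
proof -
  let ?s = "recur (\<lambda>_ x. if D \<le> x then x - D else x) r"
  \<comment> \<open>Either the remainder is reached or every round so far has subtracted
    \<open>D\<close>. After \<open>B\<close> rounds of subtraction nothing nonnegative could be left
    of \<open>r < B * D\<close>.\<close>
  have s: "0 \<le> ?s i \<and> ?s i mod D = r mod D \<and> (?s i < D \<or> ?s i + int i * D = r)" for i
  proof (induction i)
    case (Suc i)
    then show ?case by (auto simp: algebra_simps)
  qed (use assms in auto)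
  have "?s (nat B) < D"
  proof (rule ccontr)
    assume "\<not> ?s (nat B) < D"
    with s[of "nat B"] have "?s (nat B) + int (nat B) * D = r" by blast
    then show False using s[of "nat B"] assms by simp
  qed
  then have "?s (nat B) mod D = ?s (nat B)" using s[of "nat B"] by (intro mod_pos_pos_trivial) auto
  then have "?s (nat B) = r mod D" using s[of "nat B"] by linarith
  then show ?thesis using assms by (simp add: small_mod_def min_def)
qed

text \<open>The machine cannot divide, and subtracting \<open>B ^ nat j\<close> from
  \<open>c\<close> until a remainder is left can take exponentially many rounds. When the leading
  digits are stripped one by one, each stage meets a quotient below \<open>B\<close>, so
  \<open>B\<close> subtractions are enough.\<close>

definition low_part :: "memory \<Rightarrow> int \<Rightarrow> int \<Rightarrow> int \<Rightarrow> int" where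
  "low_part M B c j = recur (\<lambda>i x. if j \<le> M 0 - 1 - i
     then small_mod M B (pow M B (M 0 - 1 - i)) x else x) c (nat (M 0))"

lemma poly_low_part [poly_intros]:
  "poly_computable a \<Longrightarrow> poly_computable b \<Longrightarrow> poly_computable c \<Longrightarrow>
      poly_computable (\<lambda>M v. low_part M (a M v) (b M v) (c M v))"
  by (rule poly_subst3[where h = low_part]) (unfold low_part_def, intro poly_intros)

lemma low_part_eq:
  assumes "1 \<le> B" "B \<le> 2 * M 0 + 3" "0 \<le> j" "j \<le> M 0" "0 \<le> c" "c < B ^ nat (M 0)"
  shows "low_part M B c j = c mod B ^ nat j"
proof -
  let ?n = "nat (M 0)"
  \<comment> \<open>After \<open>k\<close> rounds the top \<open>k\<close> of the \<open>?n\<close>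
    digits are gone, except that the digits below position \<open>j\<close> always stay.\<close>
  have "recur (\<lambda>i x. if j \<le> M 0 - 1 - i then small_mod M B (pow M B (M 0 - 1 - i)) x else x) c k
      = c mod B ^ max (nat j) (?n - k)" if "k \<le> ?n" for k
    using that
  proof (induction k)
    case 0
    have "max (nat j) (?n - 0) = ?n" using assms by simp
    then show ?case using assms by (simp only: recur.simps mod_pos_pos_trivial)
  next
    case (Suc k)
    show ?case
    proof (cases "j \<le> M 0 - 1 - int k")
      case True
      let ?J = "M 0 - 1 - int k"
      have J: "?n - k = Suc (nat ?J)" "?n - Suc k = nat ?J" using Suc.prems by auto
      have m: "max (nat j) (?n - k) = Suc (nat ?J)" "max (nat j) (?n - Suc k) = nat ?J"
        using J True by auto
      have p: "pow M B ?J = B ^ nat ?J" using assms True by (intro pow_eq) auto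
      have "small_mod M B (B ^ nat ?J) (c mod B ^ Suc (nat ?J)) = c mod B ^ Suc (nat ?J)
          mod B ^ nat ?J"
        using assms by (intro small_mod_eq) (auto simp: pos_mod_bound)
      also have "\<dots> = c mod B ^ nat ?J" by (simp add: mod_mod_cancel)
      finally show ?thesis using Suc True by (simp only: recur.simps m p if_True)
    next
      case False
      then have "max (nat j) (?n - k) = max (nat j) (?n - Suc k)" by auto
      then show ?thesis using Suc False by simp
    qed
  qed
  from this[of ?n] show ?thesis by (simp add: low_part_def)
qed

text \<open>The leading one among the lowest \<open>j + 1\<close> digits is found by comparison with
  the multiples of \<open>B ^ nat j\<close>; the first multiple that exceeds the number has index
  digit plus 1.\<close>

definition digit :: "memory \<Rightarrow> int \<Rightarrow> int \<Rightarrow> int \<Rightarrow> int" where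
  "digit M B c j =
    search (\<lambda>i. low_part M B c (j + 1) < mul M (pow M B j) (i + 1)) (min B (2 * M 0 + 3))"

lemma poly_digit [poly_intros]:
  "poly_computable a \<Longrightarrow> poly_computable b \<Longrightarrow> poly_computable c \<Longrightarrow>
      poly_computable (\<lambda>M v. digit M (a M v) (b M v) (c M v))"
  by (rule poly_subst3[where h = digit]) (unfold digit_def, intro poly_intros)

lemma digit_eq:
  assumes "1 \<le> B" "B \<le> 2 * M 0 + 3" "0 \<le> j" "j < M 0" "0 \<le> c" "c < B ^ nat (M 0)"
  shows "digit M B c j = c div B ^ nat j mod B"
proof -
  define D where "D = B ^ nat j"
  define R where "R = c mod B ^ nat (j + 1)"
  define q where "q = R div D"
  have D: "0 < D" using assms by (simp add: D_def)
  have BD: "B ^ nat (j + 1) = D * B" using assms by (simp add: D_def nat_add_distrib)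
  then have R: "0 \<le> R" "R < B * D" using D assms by (simp_all add: R_def mult.commute)
  have q: "0 \<le> q" "q < B" "q = c div D mod B"
    subgoal using R(1) D by (simp add: q_def pos_imp_zdiv_nonneg_iff)
    subgoal using R(2) D by (simp add: q_def int_div_less_iff mult.commute)
    subgoal using D assms(1) by (simp add: q_def R_def BD zmod_zmult2_eq)
    done
  have iff: "(low_part M B c (j + 1) < mul M (pow M B j) (i + 1)) = (q \<le> i)" if "i \<in> {0..<B}" for i
  proof -
    have "low_part M B c (j + 1) = R" unfolding R_def using assms by (intro low_part_eq) auto
    moreover have "pow M B j = D" unfolding D_def using assms by (intro pow_eq) auto
    moreover have "mul M D (i + 1) = D * (i + 1)" using that assms by (intro mul_eq) auto
    moreover have "R < D * (i + 1) \<longleftrightarrow> q < i + 1"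
      unfolding q_def by (rule int_div_less_iff[OF D, symmetric])
    ultimately show ?thesis by simp
  qed
  define P where "P i \<longleftrightarrow> low_part M B c (j + 1) < mul M (pow M B j) (i + 1)" for i
  have P: "P i \<longleftrightarrow> q \<le> i" if "i \<in> {0..<B}" for i using iff[OF that] by (simp add: P_def)
  have "search P B = q"
  proof (rule search_cases[of P B])
    assume "\<forall>i\<in>{0..<B}. \<not> P i"
    then show ?thesis using P[of q] q(1,2) by auto
  next
    assume s: "search P B \<in> {0..<B}" "P (search P B)" "\<forall>j\<in>{0..<search P B}. \<not> P j"
    have "q \<le> search P B" using P[OF s(1)] s(2) by simp
    moreover have "\<not> q < search P B" using P[of q] q(1,2) s(3) by auto
    ultimately show ?thesis by simp
  qed
  then show ?thesis using q assms(2) by (simp add: D_def digit_def P_def[abs_def] min_def)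
qed

text \<open>It turns an arbitrary sequence of choices into a number, so a loop over the numbers
  below \<open>B ^ d\<close> meets every sequence of branchings and every guess.\<close>

lemma digits_exist:
  fixes f :: "nat \<Rightarrow> int"
  assumes "\<And>i. i < d \<Longrightarrow> 0 \<le> f i \<and> f i < B"
  shows "\<exists>c. 0 \<le> c \<and> c < B ^ d \<and> (\<forall>i<d. c div B ^ i mod B = f i)"
  using assms
proof (induction d arbitrary: f)
  case 0
  then show ?case by (intro exI[of _ 0]) auto
next
  case (Suc d)
  have "\<exists>c. 0 \<le> c \<and> c < B ^ d \<and> (\<forall>i<d. c div B ^ i mod B = f (Suc i))"
    by (rule Suc.IH) (use Suc.prems in auto)
  then obtain c where c: "0 \<le> c" "c < B ^ d" "\<And>i. i < d \<Longrightarrow> c div B ^ i mod B = f (Suc i)" by blast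
  have f0: "0 \<le> f 0" "f 0 < B" using Suc.prems by auto
  let ?c = "f 0 + B * c"
  have "?c < B * (c + 1)" using f0 by (simp add: algebra_simps)
  also have "\<dots> \<le> B * B ^ d" using c f0 by (intro mult_left_mono) auto
  finally have "?c < B ^ Suc d" by simp
  moreover have "?c div B ^ i mod B = f i" if "i < Suc d" for i
  proof (cases i)
    case 0
    then show ?thesis using f0 by simp
  next
    case (Suc i')
    have "?c div B ^ i = ?c div B div B ^ i'" using Suc f0 by (simp add: zdiv_zmult2_eq)
    also have "?c div B = c" using f0 by simp
    finally show ?thesis using c(3)[of i'] Suc that by simp
  qed
  ultimately show ?case using f0 c(1) by (intro exI[of _ ?c]) auto
qed

definition mem :: "memory \<Rightarrow> int \<Rightarrow> int \<Rightarrow> bool" where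
  "mem M m x \<longleftrightarrow> digit M 2 m x = 1"

lemma poly_mem [poly_intros]: "poly_computable a \<Longrightarrow> poly_computable b \<Longrightarrow>
    poly_decidable (\<lambda>M v. mem M (a M v) (b M v))"
  by (rule poly_subst2[where h = "\<lambda>M m x. of_bool (mem M m x)"]) (unfold mem_def, intro poly_intros)

lemma mem_iff_bit:
  assumes "0 \<le> m" "m < 2 ^ nat (M 0)" "0 \<le> x" "x < M 0"
  shows "mem M m x \<longleftrightarrow> bit m (nat x)"
  using assms by (simp add: mem_def digit_eq bit_iff_odd odd_iff_mod_2_eq_one)

section \<open>Deletion sets by branching\<close>

definition adj :: "memory \<Rightarrow> int \<Rightarrow> int \<Rightarrow> bool" where
  "adj M u v \<longleftrightarrow> M (max 0 (3 + M 0 + mul M u (M 0) + v)) = 1"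

lemma poly_adj [poly_intros]: "poly_computable a \<Longrightarrow> poly_computable b \<Longrightarrow>
    poly_decidable (\<lambda>M v. adj M (a M v) (b M v))"
  by (rule poly_subst2[where h = "\<lambda>M u v. of_bool (adj M u v)"]) (unfold adj_def, intro poly_intros)

abbreviation triple :: "memory \<Rightarrow> int \<Rightarrow> int \<Rightarrow> int \<Rightarrow> int \<Rightarrow> bool" where
  "triple M m u v w \<equiv> \<not> mem M m u \<and> \<not> mem M m v \<and> \<not> mem M m w \<and>
     adj M u v \<and> adj M v w \<and> u \<noteq> w \<and> \<not> adj M u w"

text \<open>A search yields one integer, so the vertices of the first path are found one after the
  other, each search using the earlier results. A negative \<open>triple1\<close> says that no path
  is left.\<close>

definition triple1 :: "memory \<Rightarrow> int \<Rightarrow> int" where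
  "triple1 M m = search (\<lambda>u. \<exists>v\<in>{0..<M 0}. \<exists>w\<in>{0..<M 0}. triple M m u v w) (M 0)"

definition triple2 :: "memory \<Rightarrow> int \<Rightarrow> int" where
  "triple2 M m = search (\<lambda>v. \<exists>w\<in>{0..<M 0}. triple M m (triple1 M m) v w) (M 0)"

definition triple3 :: "memory \<Rightarrow> int \<Rightarrow> int" where
  "triple3 M m = search (\<lambda>w. triple M m (triple1 M m) (triple2 M m) w) (M 0)"

text \<open>The digit \<open>a\<close> tells which vertex of the first induced path on three vertices is deleted.\<close>

definition branch :: "memory \<Rightarrow> int \<Rightarrow> int \<Rightarrow> int" where
  "branch M m a = (if triple1 M m < 0 then m
     else m + pow M 2 (if a = 0 then triple1 M m else if a = 1 then triple2 M m else triple3 M m))"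

definition mask :: "memory \<Rightarrow> int \<Rightarrow> int \<Rightarrow> int" where
  "mask M d c = recur (\<lambda>i m. branch M m (digit M 3 c i)) 0 (nat (min d (2 * M 0 + 3)))"

definition hits :: "memory \<Rightarrow> int \<Rightarrow> int \<Rightarrow> bool" where
  "hits M d c \<longleftrightarrow> triple1 M (mask M d c) < 0"

lemma poly_triple1 [poly_intros]: "poly_computable a \<Longrightarrow> poly_computable (\<lambda>M v. triple1 M (a M v))"
  by (rule poly_subst1[where h = triple1]) (unfold triple1_def, intro poly_intros)

lemma poly_triple2 [poly_intros]: "poly_computable a \<Longrightarrow> poly_computable (\<lambda>M v. triple2 M (a M v))"
  by (rule poly_subst1[where h = triple2]) (unfold triple2_def, intro poly_intros)

lemma poly_triple3 [poly_intros]: "poly_computable a \<Longrightarrow> poly_computable (\<lambda>M v. triple3 M (a M v))"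
  by (rule poly_subst1[where h = triple3]) (unfold triple3_def, intro poly_intros)

lemma poly_branch [poly_intros]: "poly_computable a \<Longrightarrow> poly_computable b \<Longrightarrow>
    poly_computable (\<lambda>M v. branch M (a M v) (b M v))"
  by (rule poly_subst2[where h = branch]) (unfold branch_def, intro poly_intros)

lemma poly_mask [poly_intros]: "poly_computable a \<Longrightarrow> poly_computable b \<Longrightarrow>
    poly_computable (\<lambda>M v. mask M (a M v) (b M v))"
  by (rule poly_subst2[where h = mask]) (unfold mask_def, intro poly_intros)

lemma poly_hits [poly_intros]: "poly_computable a \<Longrightarrow> poly_computable b \<Longrightarrow>
    poly_decidable (\<lambda>M v. hits M (a M v) (b M v))"
  by (rule poly_subst2[where h = "\<lambda>M d c. of_bool (hits M d c)"]) (unfold hits_def, intro poly_intros)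

text \<open>The proof establishes that this is at most the distance to cluster, which suffices
  because \<open>(2 * d) ^ d\<close> grows with \<open>d\<close>.\<close>

definition cluster_distance :: "memory \<Rightarrow> int" where
  "cluster_distance M = search (\<lambda>d. \<exists>c\<in>{0..<pow M 3 d}. hits M d c) (M 0 + 1)"

definition modulator :: "memory \<Rightarrow> int" where
  "modulator M = mask M (cluster_distance M) (search (hits M (cluster_distance M))
      (pow M 3 (cluster_distance M)))"

section \<open>Correctness of the branching\<close>

definition members :: "memory \<Rightarrow> int \<Rightarrow> int set" where
  "members M m = {x \<in> {0..<M 0}. mem M m x}"

text \<open>Cluster graphs are the graphs without an induced path on three vertices. In this local
  form the machine can test the property without a partition into cliques.\<close>

definition cluster_off :: "memory \<Rightarrow> int set \<Rightarrow> bool" where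
  "cluster_off M X \<longleftrightarrow> (\<forall>u\<in>{0..<M 0} - X. \<forall>v\<in>{0..<M 0} - X. \<forall>w\<in>{0..<M 0} - X.
     adj M u v \<and> adj M v w \<and> u \<noteq> w \<longrightarrow> adj M u w)"

lemma triple1_neg_iff: "triple1 M m < 0 \<longleftrightarrow> cluster_off M (members M m)"
proof -
  have "triple1 M m \<ge> 0 \<longleftrightarrow> \<not> cluster_off M (members M m)"
    unfolding triple1_def search_ge_0_iff cluster_off_def members_def by blast
  then show ?thesis by linarith
qed

lemma triples:
  assumes "triple1 M m \<ge> 0"
  shows "triple1 M m \<in> {0..<M 0}" "triple2 M m \<in> {0..<M 0}" "triple3 M m \<in> {0..<M 0}"
    "triple M m (triple1 M m) (triple2 M m) (triple3 M m)"
proof -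
  obtain u where u: "u \<in> {0..<M 0}" "\<exists>v\<in>{0..<M 0}. \<exists>w\<in>{0..<M 0}. triple M m u v w"
    using assms unfolding triple1_def search_ge_0_iff by blast
  note 1 = search_witness[of _ _ "\<lambda>u. \<exists>v\<in>{0..<M 0}. \<exists>w\<in>{0..<M 0}. triple M m u v w", OF u, folded
      triple1_def]
  then obtain v where v: "v \<in> {0..<M 0}" "\<exists>w\<in>{0..<M 0}. triple M m (triple1 M m) v w" by blast
  note 2 = search_witness[of _ _ "\<lambda>v. \<exists>w\<in>{0..<M 0}. triple M m (triple1 M m)
      v w", OF v, folded triple2_def]
  then obtain w where w: "w \<in> {0..<M 0}" "triple M m (triple1 M m) (triple2 M m) w" by blast
  note 3 = search_witness[of _ _ "triple M m (triple1 M m) (triple2 M m)", OF w, folded triple3_def]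
  show "triple1 M m \<in> {0..<M 0}" "triple2 M m \<in> {0..<M 0}" "triple3 M m \<in> {0..<M 0}"
    "triple M m (triple1 M m) (triple2 M m) (triple3 M m)"
    using 1(1) 2(1) 3 by blast+
qed

definition is_mask :: "memory \<Rightarrow> int \<Rightarrow> bool" where
  "is_mask M m \<longleftrightarrow> 0 \<le> m \<and> m < 2 ^ nat (M 0)"

text \<open>The bit at \<open>x\<close> is clear, so adding the power causes no carry and just sets
  it.\<close>

lemma mask_insert:
  assumes m: "is_mask M m" and x: "x \<in> {0..<M 0}" "\<not> mem M m x"
  shows "is_mask M (m + pow M 2 x)" "members M (m + pow M 2 x) = insert x (members M m)"
proof -
  have "pow M 2 x = 2 ^ nat x" using x by (intro pow_eq) auto
  moreover have "\<not> bit m (nat x)" using m x mem_iff_bit[of m M x] by (auto simp: is_mask_def)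
  ultimately have s: "m + pow M 2 x = set_bit (nat x) m" by (simp add: set_bit_eq)
  have nx: "\<not> nat (M 0) \<le> nat x" using x by auto
  have "take_bit (nat (M 0)) m = m" using m by (simp add: is_mask_def take_bit_int_eq_self_iff)
  then have "take_bit (nat (M 0)) (set_bit (nat x) m) = set_bit (nat x) m"
    using nx by (simp add: take_bit_set_bit_eq)
  then show i: "is_mask M (m + pow M 2 x)"
    unfolding s by (simp add: is_mask_def take_bit_int_eq_self_iff)
  have "mem M (m + pow M 2 x) y \<longleftrightarrow> mem M m y \<or> y = x" if "y \<in> {0..<M 0}" for y
  proof -
    have "mem M (m + pow M 2 x) y \<longleftrightarrow> bit (set_bit (nat x) m) (nat y)"
      using i that by (simp add: mem_iff_bit is_mask_def flip: s)
    also have "\<dots> \<longleftrightarrow> bit m (nat y) \<or> x = y" using x that by (auto simp: bit_set_bit_iff)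
    also have "bit m (nat y) \<longleftrightarrow> mem M m y" using m that by (simp add: mem_iff_bit is_mask_def)
    finally show ?thesis by auto
  qed
  then show "members M (m + pow M 2 x) = insert x (members M m)"
    using x by (auto simp: members_def)
qed

lemma finite_members: "finite (members M m)"
  by (rule finite_subset[of _ "{0..<M 0}"]) (auto simp: members_def)

lemma branch_cases:
  assumes "is_mask M m"
  obtains "triple1 M m < 0" "branch M m a = m"
  | x where "triple1 M m \<ge> 0" "x = (if a = 0 then triple1 M m else if a =
      1 then triple2 M m else triple3 M m)"
      "x \<in> {0..<M 0}" "x \<notin> members M m" "is_mask M (branch M m a)" "members M (branch M m a) =
          insert x (members M m)"
proof (cases "triple1 M m < 0")
  case True
  then show ?thesis using that(1) by (simp add: branch_def)
next
  case False
  define x where "x = (if a = 0 then triple1 M m else if a = 1 then triple2 M m else triple3 M m)"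
  have b: "branch M m a = m + pow M 2 x" using False by (simp add: branch_def x_def)
  have x: "x \<in> {0..<M 0}" "\<not> mem M m x" using triples[of M m] False by (auto simp: x_def)
  show ?thesis
    using False x mask_insert[OF assms x] that(2)[OF _ x_def] by (simp add: b members_def)
qed

lemma mask_bounds:
  assumes "0 \<le> d"
  shows "is_mask M (mask M d c) \<and> card (members M (mask M d c)) \<le> nat d"
proof -
  let ?s = "recur (\<lambda>i m. branch M m (digit M 3 c i)) 0"
  have "is_mask M (?s k) \<and> card (members M (?s k)) \<le> k" for k
  proof (induction k)
    case 0
    have "\<not> mem M 0 x" if "x \<in> {0..<M 0}" for x using that mem_iff_bit[of 0 M x] by simp
    then have "members M 0 = {}" by (auto simp: members_def)
    then show ?case by (simp add: is_mask_def)
  next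
    case (Suc k)
    then have "is_mask M (?s k)" by blast
    then show ?case
    proof (cases rule: branch_cases[of M "?s k" "digit M 3 c (int k)"])
      case 1
      then show ?thesis using Suc by simp
    next
      case (2 x)
      then show ?thesis using Suc by (simp add: finite_members)
    qed
  qed
  from this[of "nat (min d (2 * M 0 + 3))"] show ?thesis unfolding mask_def by linarith
qed

text \<open>Every induced path on three vertices meets \<open>X\<close>, so each branching can pick
  a vertex of \<open>X\<close>. The picked vertices are distinct; hence either no path is left at
  some earlier stage, or all of \<open>X\<close> has been picked after \<open>card X\<close>
  branchings.\<close>

lemma exists_hit:
  assumes X: "X \<subseteq> {0..<M 0}" "cluster_off M X"
  shows "\<exists>c\<in>{0..<pow M 3 (int (card X))}. hits M (int (card X)) c"
proof -
  let ?d = "card X"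
  have fX: "finite X" using X(1) finite_subset by blast
  have "?d \<le> card {0..<M 0}" using X(1) by (intro card_mono) auto
  then have dn: "?d \<le> nat (M 0)" by simp
  define pick where "pick m = (SOME a. a \<in> {0, 1, 2::int} \<and>
    (if a = 0 then triple1 M m else if a = 1 then triple2 M m else triple3 M m) \<in> X)" for m
  have pick: "pick m \<in> {0, 1, 2} \<and>
    (if pick m = 0 then triple1 M m else if pick m = 1 then triple2 M m else triple3 M m) \<in> X"
    if "triple1 M m \<ge> 0" for m
  proof -
    have "triple1 M m \<in> X \<or> triple2 M m \<in> X \<or> triple3 M m \<in> X"
      using X(2) triples[OF that] unfolding cluster_off_def by blast
    then have "\<exists>a. a \<in> {0, 1, 2::int} \<and>
        (if a = 0 then triple1 M m else if a = 1 then triple2 M m else triple3 M m) \<in> X"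
    proof (elim disjE)
      assume "triple1 M m \<in> X" then show ?thesis by (intro exI[of _ 0]) auto
    next
      assume "triple2 M m \<in> X" then show ?thesis by (intro exI[of _ 1]) auto
    next
      assume "triple3 M m \<in> X" then show ?thesis by (intro exI[of _ 2]) auto
    qed
    then show ?thesis unfolding pick_def by (rule someI_ex)
  qed
  \<comment> \<open>Once no path is left, \<open>branch\<close> ignores the digit; 0 merely keeps it
    valid in base 3.\<close>
  define pick' where "pick' m = (if triple1 M m \<ge> 0 then pick m else 0)" for m
  have pick': "0 \<le> pick' m \<and> pick' m < 3" for m using pick[of m] by (auto simp: pick'_def)
  define s where "s = recur (\<lambda>i m. branch M m (pick' m)) 0"
  have s: "is_mask M (s k) \<and> (triple1 M (s k) < 0 \<or> members M (s k) \<subseteq> X \<and> card (members M (s k))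
      = k)" for k
  proof (induction k)
    case 0
    have "\<not> mem M 0 x" if "x \<in> {0..<M 0}" for x using that mem_iff_bit[of 0 M x] by simp
    then have "members M 0 = {}" by (auto simp: members_def)
    then show ?case by (simp add: is_mask_def s_def)
  next
    case (Suc k)
    have e: "s (Suc k) = branch M (s k) (pick' (s k))" by (simp add: s_def)
    have "is_mask M (s k)" using Suc by blast
    then show ?case
    proof (cases rule: branch_cases[of M "s k" "pick' (s k)"])
      case 1
      then show ?thesis using Suc e by simp
    next
      case (2 x)
      then have "pick' (s k) = pick (s k)" by (simp add: pick'_def)
      with 2(2) have "x = (if pick (s k) = 0 then triple1 M (s k)
          else if pick (s k) = 1 then triple2 M (s k) else triple3 M (s k))" by simp
      with pick[OF 2(1)] have "x \<in> X" by (simp only:)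
      then show ?thesis using 2(1,4,5,6) Suc e by (simp add: finite_members)
    qed
  qed
  have final: "triple1 M (s ?d) < 0"
  proof (rule ccontr)
    assume a: "\<not> triple1 M (s ?d) < 0"
    then have "members M (s ?d) = X" using s[of ?d] fX by (metis card_subset_eq)
    then show False using a X(2) by (simp add: triple1_neg_iff)
  qed
  obtain c where c: "0 \<le> c" "c < 3 ^ ?d" "\<And>i. i < ?d \<Longrightarrow> c div 3 ^ i mod 3 = pick' (s i)"
    using digits_exist[of ?d "\<lambda>i. pick' (s i)" 3] pick' by blast
  have "(3::int) ^ ?d \<le> 3 ^ nat (M 0)" using dn by (intro power_increasing) auto
  then have "c < 3 ^ nat (M 0)" using c(2) by linarith
  then have dig: "digit M 3 c (int i) = pick' (s i)" if "i < ?d" for i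
    using c that dn by (subst digit_eq) auto
  have "recur (\<lambda>i m. branch M m (digit M 3 c i)) 0 k = s k" if "k \<le> ?d" for k
    using that by (induction k) (auto simp: s_def dig)
  from this[of ?d] have "mask M (int ?d) c = s ?d"
    using dn by (cases "M 0 \<ge> 0") (simp_all add: mask_def min_def s_def)
  moreover have "pow M 3 (int ?d) = 3 ^ ?d"
  proof (cases "M 0 \<ge> 0")
    case True
    then show ?thesis using dn by (subst pow_eq) auto
  next
    case False
    then have "X = {}" using X(1) by auto
    then show ?thesis by (simp add: pow_def min_def)
  qed
  ultimately show ?thesis using c final by (intro bexI[of _ c]) (auto simp: hits_def)
qed

lemma cluster_distance_le:
  assumes X: "X \<subseteq> {0..<M 0}" "cluster_off M X" and "M 0 \<ge> 0"
  shows "0 \<le> cluster_distance M" "cluster_distance M \<le> int (card X)" "cluster_distance M \<le> M 0"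
proof -
  have "card X \<le> card {0..<M 0}" using X(1) by (intro card_mono) auto
  then have d: "int (card X) \<in> {0..<M 0 + 1}" using assms(3) by auto
  let ?P = "\<lambda>d. \<exists>c\<in>{0..<pow M 3 d}. hits M d c"
  note hit = exists_hit[OF X]
  have w: "cluster_distance M \<in> {0..<M 0 + 1}"
    using search_witness(1)[of _ _ ?P, OF d hit] unfolding cluster_distance_def .
  then show "0 \<le> cluster_distance M" "cluster_distance M \<le> M 0" by simp_all
  show "cluster_distance M \<le> int (card X)"
    using search_le[of _ _ ?P, OF d hit] unfolding cluster_distance_def .
qed

lemma modulator_correct:
  assumes "cluster_distance M \<ge> 0"
  shows "is_mask M (modulator M)" "card (members M (modulator M)) \<le> nat (cluster_distance M)"
    "cluster_off M (members M (modulator M))"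
proof -
  show "is_mask M (modulator M)" "card (members M (modulator M)) \<le> nat (cluster_distance M)"
    using mask_bounds[OF assms] unfolding modulator_def by blast+
  let ?P = "\<lambda>d. \<exists>c\<in>{0..<pow M 3 d}. hits M d c"
  have "?P (cluster_distance M)"
    using assms search_witness[of _ "M 0 + 1" ?P] unfolding cluster_distance_def search_ge_0_iff
        by blast
  then have "hits M (cluster_distance M) (search (hits M (cluster_distance M))
      (pow M 3 (cluster_distance M)))"
    using search_witness(2) by blast
  then show "cluster_off M (members M (modulator M))"
    by (simp add: hits_def triple1_neg_iff modulator_def)
qed

section \<open>Completing a guess on the modulator\<close>

text \<open>A guess consists of the set \<open>H\<close> of happy vertices of the modulator \<open>X\<close> and of the
  partition of \<open>X\<close> into colour classes, the fibres of \<open>g\<close>. Vertices are the integers in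
  \<open>{0..<n}\<close>, and \<open>p v = 0\<close> means that \<open>v\<close> is not precoloured.\<close>

locale guess =
  fixes n :: int and E :: "int \<Rightarrow> int \<Rightarrow> bool" and p :: "int \<Rightarrow> int"
    and X H :: "int \<Rightarrow> bool" and g :: "int \<Rightarrow> int"
begin

definition clique :: "int \<Rightarrow> int \<Rightarrow> bool" where
  "clique v u \<longleftrightarrow> \<not> X u \<and> (u = v \<or> E v u)"

text \<open>The vertices of \<open>X\<close> that share the colour of \<open>v\<close> whenever
  \<open>v\<close> is happy: a happy \<open>v\<close> makes its clique monochromatic, and a happy
  \<open>x\<close> has the colour of each of its neighbours there.\<close>

definition bound :: "int \<Rightarrow> int \<Rightarrow> bool" where
  "bound v x \<longleftrightarrow> X x \<and> (E v x \<or> H x \<and> (\<exists>u\<in>{0..<n}. clique v u \<and> E u x))"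

definition inside :: "int \<Rightarrow> int \<Rightarrow> bool" where
  "inside v j \<longleftrightarrow> (\<forall>x\<in>{0..<n}. bound v x \<longrightarrow> g x = j)"

definition clique_precoloured :: "int \<Rightarrow> int \<Rightarrow> bool" where
  "clique_precoloured v a \<longleftrightarrow> (\<exists>u\<in>{0..<n}. clique v u \<and> p u \<noteq> 0) \<and>
     (\<forall>u\<in>{0..<n}. clique v u \<and> p u \<noteq> 0 \<longrightarrow> p u = a)"

text \<open>Vertices without any bound vertex are left out: they would be counted for every group,
  while their happiness does not depend on the colours of the groups.\<close>

definition weight :: "int \<Rightarrow> int \<Rightarrow> int" where
  "weight j a = (\<Sum>v\<in>{0..<n}. of_bool (\<not> X v \<and> clique_precoloured v a \<and>
     (\<exists>x\<in>{0..<n}. bound v x) \<and> inside v j))"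

text \<open>A colour that no vertex is precoloured with has weight 0, so the precolours suffice as
  candidates. The default 1 is legal as soon as a nonempty graph has a legal colouring at all, so
  every vertex supplies a candidate.\<close>

definition candidate :: "int \<Rightarrow> int" where
  "candidate y = (if p y = 0 then 1 else p y)"

definition forces :: "int \<Rightarrow> int \<Rightarrow> bool" where
  "forces j u \<longleftrightarrow> p u \<noteq> 0 \<and> (X u \<and> g u = j \<or> (\<exists>h\<in>{0..<n}. H h \<and> g h = j \<and> E h u))"

definition best_candidate :: "int \<Rightarrow> int" where
  "best_candidate j =
    search (\<lambda>y. \<forall>z\<in>{0..<n}. weight j (candidate z) \<le> weight j (candidate y)) n"

definition group_colour :: "int \<Rightarrow> int" where
  "group_colour j = (let u = search (forces j) n in
     if u < 0 then candidate (best_candidate j) else p u)"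

definition score :: "int \<Rightarrow> int \<Rightarrow> int" where
  "score v j = (\<Sum>u\<in>{0..<n}. of_bool (clique v u \<and> inside u j))"

definition best_group :: "int \<Rightarrow> int" where
  "best_group v = search (\<lambda>j. \<forall>i\<in>{0..<n + 1}. score v i \<le> score v j) (n + 1)"

definition clique_colour :: "int \<Rightarrow> int" where
  "clique_colour v = (let u = search (\<lambda>u. clique v u \<and> p u \<noteq> 0) n in
     if u < 0 then group_colour (best_group v) else p u)"

text \<open>A vertex off \<open>X\<close> next to a vertex guessed to be happy has no choice but to
  follow it; only the remaining ones are free to follow their clique. If the guess is right, several
  happy neighbours lie in one group, so any of them will do.\<close>

definition colour :: "int \<Rightarrow> int" where
  "colour v = (if X v then group_colour (g v)
     else if p v \<noteq> 0 then p v
     else let h = search (\<lambda>h. H h \<and> E v h) n in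
       if h < 0 then clique_colour v else group_colour (g h))"

definition good :: "int \<Rightarrow> int \<Rightarrow> bool" where
  "good l k \<longleftrightarrow>
    (\<forall>v\<in>{0..<n}. 1 \<le> colour v \<and> colour v \<le> l \<and> (p v \<noteq> 0 \<longrightarrow> colour v = p v)) \<and>
    k \<le> (\<Sum>v\<in>{0..<n}. of_bool (\<forall>u\<in>{0..<n}. E u v \<longrightarrow> colour u = colour v))"

end

lemma search_argmax:
  fixes f :: "int \<Rightarrow> int"
  assumes "0 < N"
  defines "m \<equiv> search (\<lambda>y. \<forall>z\<in>{0..<N}. f z \<le> f y) N"
  shows "m \<in> {0..<N}" "\<And>z. z \<in> {0..<N} \<Longrightarrow> f z \<le> f m"
proof -
  have "Max (f ` {0..<N}) \<in> f ` {0..<N}" using assms by (intro Max_in) auto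
  then obtain y where y: "y \<in> {0..<N}" "f y = Max (f ` {0..<N})" by auto
  then have "\<forall>z\<in>{0..<N}. f z \<le> f y" by simp
  from search_witness[of y N "\<lambda>y. \<forall>z\<in>{0..<N}. f z \<le> f y", OF y(1) this]
  show "m \<in> {0..<N}" "\<And>z. z \<in> {0..<N} \<Longrightarrow> f z \<le> f m" unfolding m_def by blast+
qed

lemma finite_int_segment [simp]: "finite {x :: int. a \<le> x \<and> x < b \<and> Q x}"
  by (rule finite_subset[of _ "{a..<b}"]) auto

lemma sum_of_bool_card: "finite A \<Longrightarrow> (\<Sum>v\<in>A. of_bool (P v)) = int (card {v \<in> A. P v})"
  by (simp add: Int_def flip: sum.inter_filter)

text \<open>\<open>cs\<close> is the colouring to compete with.\<close>

locale right_guess = guess +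
  fixes cs :: "int \<Rightarrow> int" and l :: int
  assumes sym: "\<And>u v. u \<in> {0..<n} \<Longrightarrow> v \<in> {0..<n} \<Longrightarrow> E u v \<Longrightarrow> E v u"
    and cluster: "\<And>u v w. u \<in> {0..<n} \<Longrightarrow> v \<in> {0..<n} \<Longrightarrow> w \<in> {0..<n} \<Longrightarrow> \<not> X u \<Longrightarrow> \<not> X v \<Longrightarrow> \<not> X w \<Longrightarrow>
      E u v \<Longrightarrow> E v w \<Longrightarrow> u \<noteq> w \<Longrightarrow> E u w"
    and cs_range: "\<And>v. v \<in> {0..<n} \<Longrightarrow> 1 \<le> cs v \<and> cs v \<le> l"
    and cs_extends: "\<And>v. v \<in> {0..<n} \<Longrightarrow> p v \<noteq> 0 \<Longrightarrow> cs v = p v"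
    and H_iff: "\<And>x. x \<in> {0..<n} \<Longrightarrow> H x \<longleftrightarrow> X x \<and> (\<forall>u\<in>{0..<n}. E u x \<longrightarrow> cs u = cs x)"
    and g_range: "\<And>x. x \<in> {0..<n} \<Longrightarrow> X x \<Longrightarrow> g x \<in> {0..<n}"
    and g_eq_iff: "\<And>x y. x \<in> {0..<n} \<Longrightarrow> y \<in> {0..<n} \<Longrightarrow> X x \<Longrightarrow> X y \<Longrightarrow> g x = g y \<longleftrightarrow> cs x = cs y"
begin

abbreviation V :: "int set" where "V \<equiv> {0..<n}"

definition S :: "int set" where "S = {v \<in> V. \<forall>u\<in>V. E u v \<longrightarrow> cs u = cs v}"

definition T :: "int set" where "T = {v \<in> V. \<forall>u\<in>V. E u v \<longrightarrow> colour u = colour v}"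

lemma finite_ST: "finite S" "finite T"
  by (simp_all add: S_def T_def)

lemma H_D: "h \<in> V \<Longrightarrow> H h \<Longrightarrow> X h" "h \<in> V \<Longrightarrow> H h \<Longrightarrow> u \<in> V \<Longrightarrow> E u h \<Longrightarrow> cs u = cs h"
  using H_iff by blast+

lemma clique_eq:
  assumes "v \<in> V" "u \<in> V" "w \<in> V" "\<not> X v" "clique v u"
  shows "clique u w \<longleftrightarrow> clique v w"
  using assms sym cluster unfolding clique_def by metis

text \<open>A vertex forces a group by lying in it or by being next to one of its happy members, and
  in both cases \<open>cs\<close> gives it the colour of the group. Hence it does not matter which
  forcing vertex the search finds.\<close>

lemma forces_eq:
  assumes "x \<in> V" "X x" "u \<in> V" "forces (g x) u"
  shows "p u = cs x"
proof -
  have pu: "cs u = p u" using assms cs_extends unfolding forces_def by blast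
  from assms(4) consider "X u" "g u = g x" | h where "h \<in> V" "H h" "g h = g x" "E h u"
    unfolding forces_def by blast
  then show ?thesis
  proof cases
    case 1
    then show ?thesis using assms g_eq_iff pu by metis
  next
    case 2
    then have "cs u = cs h" using H_D(2) sym assms(3) by blast
    moreover have "cs h = cs x" using 2 H_D(1) g_eq_iff assms by blast
    ultimately show ?thesis using pu by simp
  qed
qed

lemma forced_colour:
  assumes "x \<in> V" "X x" "u \<in> V" "forces (g x) u"
  shows "group_colour (g x) = cs x"
proof -
  note s = search_witness[of u n "forces (g x)", OF assms(3,4)]
  then have "p (search (forces (g x)) n) = cs x" using forces_eq[OF assms(1,2)] by blast
  then show ?thesis using s(1) by (simp add: group_colour_def)
qed

lemma weight_card:
  "weight j a = int (card {v \<in> V. \<not> X v \<and> clique_precoloured v a \<and> (\<exists>x\<in>V. bound v x) \<and> inside v j})"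
  unfolding weight_def by (rule sum_of_bool_card) simp

text \<open>A forced group has the colour that \<open>cs\<close> gives it. Otherwise either
  \<open>cs x\<close> is a candidate and loses to the maximum, or no vertex is precoloured with it
  and its weight is 0.\<close>

lemma weight_group_colour:
  assumes "x \<in> V" "X x"
  shows "weight (g x) (cs x) \<le> weight (g x) (group_colour (g x))"
proof (cases "\<exists>u\<in>V. forces (g x) u")
  case True
  then show ?thesis using forced_colour assms by fastforce
next
  case False
  then have c: "group_colour (g x) = candidate (best_candidate (g x))"
    unfolding group_colour_def Let_def by (simp add: search_neg_iff)
  have n: "0 < n" using assms by auto
  show ?thesis
  proof (cases "\<exists>z\<in>V. candidate z = cs x")
    case True
    then obtain z where z: "z \<in> V" "candidate z = cs x" by blast
    show ?thesis
      unfolding c best_candidate_def z(2)[symmetric]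
      by (rule search_argmax(2)[OF n z(1), where f = "\<lambda>z. weight (g x) (candidate z)"])
  next
    case False
    have "\<not> clique_precoloured v (cs x)" for v
    proof
      assume "clique_precoloured v (cs x)"
      then obtain u where "u \<in> V" "p u \<noteq> 0" "p u = cs x" unfolding clique_precoloured_def by blast
      then have "candidate u = cs x" by (simp add: candidate_def)
      then show False using False \<open>u \<in> V\<close> by blast
    qed
    then have "weight (g x) (cs x) = 0" by (simp add: weight_def)
    moreover have "0 \<le> weight (g x) (group_colour (g x))" unfolding weight_def
        by (rule sum_nonneg) simp
    ultimately show ?thesis by simp
  qed
qed

lemma group_colour_range:
  assumes "0 < n"
  shows "1 \<le> group_colour j \<and> group_colour j \<le> l"
proof -
  have p: "1 \<le> p u \<and> p u \<le> l" if "u \<in> V" "p u \<noteq> 0" for u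
    using cs_range[OF that(1)] cs_extends[OF that] by simp
  have l: "1 \<le> l" using cs_range[of 0] assms by simp
  show ?thesis
  proof (cases "search (forces j) n < 0")
    case True
    have "best_candidate j \<in> V"
      unfolding best_candidate_def by (rule search_argmax(1)[OF assms])
    then show ?thesis using True p l by (auto simp: group_colour_def candidate_def)
  next
    case False
    then obtain u where "u \<in> V" "forces j u" unfolding search_neg_iff by blast
    then have "search (forces j) n \<in> V" "forces j (search (forces j) n)"
      using search_witness[of u n "forces j"] by blast+
    then show ?thesis using False p by (simp add: group_colour_def forces_def)
  qed
qed

lemma search_H:
  assumes "v \<in> V" "\<not> X v" "p v = 0"
  obtains h where "h \<in> V" "H h" "E v h" "colour v = group_colour (g h)"
  | "\<forall>h\<in>V. \<not> (H h \<and> E v h)" "colour v = clique_colour v"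
proof (cases "search (\<lambda>h. H h \<and> E v h) n < 0")
  case True
  then show ?thesis using that(2) assms by (simp add: colour_def search_neg_iff)
next
  case False
  then obtain h where "h \<in> V" "H h \<and> E v h" unfolding search_neg_iff by blast
  from search_witness[of h n "\<lambda>h. H h \<and> E v h", OF this] show ?thesis
    using assms False by (intro that(1)[of "search (\<lambda>h. H h \<and> E v h) n"]) (simp_all add: colour_def)
qed

lemma search_precoloured:
  obtains u where "u \<in> V" "clique v u" "p u \<noteq> 0" "clique_colour v = p u"
  | "\<forall>u\<in>V. \<not> (clique v u \<and> p u \<noteq> 0)" "clique_colour v = group_colour (best_group v)"
proof (cases "search (\<lambda>u. clique v u \<and> p u \<noteq> 0) n < 0")
  case True
  then show ?thesis using that(2) by (simp add: clique_colour_def search_neg_iff)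
next
  case False
  then obtain u where "u \<in> V" "clique v u \<and> p u \<noteq> 0" unfolding search_neg_iff by blast
  from search_witness[of u n "\<lambda>u. clique v u \<and> p u \<noteq> 0", OF this] show ?thesis
    using False
    by (intro that(1)[of "search (\<lambda>u. clique v u \<and> p u \<noteq> 0) n"]) (simp_all add: clique_colour_def)
qed

lemma colour_legal:
  assumes "v \<in> V"
  shows "1 \<le> colour v \<and> colour v \<le> l \<and> (p v \<noteq> 0 \<longrightarrow> colour v = p v)"
proof (cases "X v")
  case True
  have "0 < n" using assms by auto
  moreover have "colour v = p v" if "p v \<noteq> 0"
    using forced_colour[OF assms True assms] that True cs_extends[OF assms that]
    by (simp add: forces_def colour_def)
  ultimately show ?thesis using group_colour_range True by (simp add: colour_def)
next
  case False
  have p: "1 \<le> p u \<and> p u \<le> l" if "u \<in> V" "p u \<noteq> 0" for u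
    using cs_range[OF that(1)] cs_extends[OF that] by simp
  have n: "0 < n" using assms by auto
  have "1 \<le> clique_colour v \<and> clique_colour v \<le> l"
    by (rule search_precoloured[of v]) (use p group_colour_range[OF n] in auto)
  then show ?thesis
    using p[OF assms] False group_colour_range[OF n] unfolding colour_def by (auto simp: Let_def)
qed

text \<open>Neighbours in \<open>X\<close> share the group of \<open>h\<close>, and precoloured
  neighbours off \<open>X\<close> force the colour of that group. Any other neighbour follows some
  happy \<open>h'\<close> next to it, and the group of \<open>h'\<close> is that of
  \<open>h\<close>, because \<open>cs\<close> gives all three vertices the same colour.\<close>

lemma H_happy:
  assumes h: "h \<in> V" "H h"
  shows "h \<in> T"
proof -
  have "colour u = colour h" if u: "u \<in> V" "E u h" for u
  proof -
    have X: "X h" using H_D(1) h .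
    have cu: "cs u = cs h" using H_D(2) h u .
    show ?thesis
    proof (cases "X u")
      case True
      then have "g u = g h" using cu g_eq_iff u(1) h(1) X by blast
      then show ?thesis using X True by (simp add: colour_def)
    next
      case nX: False
      show ?thesis
      proof (cases "p u = 0")
        case True
        show ?thesis
        proof (rule search_H[OF u(1) nX True])
          fix h' assume h': "h' \<in> V" "H h'" "E u h'" "colour u = group_colour (g h')"
          have "cs u = cs h'" using H_D(2) h'(1,2) u(1) h'(3) .
          then have "g h' = g h" using cu g_eq_iff h'(1) h(1) X H_D(1)[OF h'(1,2)] by simp
          then show ?thesis using h'(4) X by (simp add: colour_def)
        qed (use u h in blast)
      next
        case False
        have "E h u" using sym u h by blast
        then have "forces (g h) u" using False h unfolding forces_def by blast
        from forced_colour[OF h(1) X u(1) this] show ?thesis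
          using False nX X cu cs_extends[OF u(1) False] by (simp add: colour_def)
      qed
    qed
  qed
  then show ?thesis using h by (simp add: T_def)
qed

lemma happy_if:
  assumes "v \<in> V" "\<not> X v" "\<And>u. u \<in> V \<Longrightarrow> clique v u \<Longrightarrow> colour u = b"
    and "\<And>x. x \<in> V \<Longrightarrow> X x \<Longrightarrow> E v x \<Longrightarrow> colour x = b"
  shows "v \<in> T"
proof -
  have "colour v = b" using assms(1-3) by (simp add: clique_def)
  moreover have "colour u = b" if "u \<in> V" "E u v" for u
  proof -
    have "E v u" using sym that assms(1) by blast
    then show ?thesis using assms(3,4) that(1) by (cases "X u") (simp_all add: clique_def)
  qed
  ultimately show ?thesis using assms(1) by (simp add: T_def)
qed

lemma S_clique:
  assumes "v \<in> S" "u \<in> V" "clique v u"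
  shows "cs u = cs v"
  using assms sym unfolding S_def clique_def by blast

lemma S_bound:
  assumes "v \<in> S" "\<not> X v" "x \<in> V" "bound v x"
  shows "cs x = cs v"
proof -
  have v: "v \<in> V" using assms by (simp add: S_def)
  from assms(4) consider "E v x" | u where "H x" "u \<in> V" "clique v u" "E u x"
    unfolding bound_def by blast
  then show ?thesis
  proof cases
    case 1
    then show ?thesis using assms sym v unfolding S_def by blast
  next
    case 2
    then show ?thesis using H_D(2)[OF assms(3)] S_clique[OF assms(1)] by metis
  qed
qed

lemma S_precoloured:
  assumes "v \<in> S" "u \<in> V" "clique v u" "p u \<noteq> 0"
  shows "clique_precoloured v (cs v)"
  using assms S_clique[OF assms(1)] cs_extends unfolding clique_precoloured_def by metis

text \<open>Every vertex of the clique gets the colour \<open>a\<close>: by its precolour, by a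
  happy neighbour, which is then bound to \<open>v\<close>, or by \<open>clique_colour\<close>,
  which copies a precolour found in the clique.\<close>

lemma precoloured_happy:
  assumes v: "v \<in> V" "\<not> X v" "clique_precoloured v a"
    and b: "\<And>x. x \<in> V \<Longrightarrow> bound v x \<Longrightarrow> group_colour (g x) = a"
  shows "v \<in> T"
proof (rule happy_if[OF v(1,2)])
  fix x assume "x \<in> V" "X x" "E v x"
  then show "colour x = a" using b[of x] by (simp add: colour_def bound_def)
next
  fix u assume u: "u \<in> V" "clique v u"
  then have nX: "\<not> X u" by (simp add: clique_def)
  show "colour u = a"
  proof (cases "p u = 0")
    case True
    from search_H[OF u(1) nX True] show ?thesis
    proof cases
      case (1 h)
      then have "bound v h" using u H_D(1) unfolding bound_def by blast
      then show ?thesis using 1 b by simp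
    next
      case 2
      from search_precoloured[of u] show ?thesis
      proof cases
        case (1 w)
        then have "clique v w" using clique_eq[OF v(1) u(1) _ v(2) u(2)] by blast
        then have "p w = a" using 1 v(3) unfolding clique_precoloured_def by blast
        then show ?thesis using 1 2 by simp
      next
        case 2
        then show ?thesis
          using v(3) clique_eq[OF v(1) u(1) _ v(2) u(2)] unfolding clique_precoloured_def by blast
      qed
    qed
  next
    case False
    then have "p u = a" using u v(3) unfolding clique_precoloured_def by blast
    then show ?thesis using False nX by (simp add: colour_def)
  qed
qed

section \<open>Counting happy vertices in cliques with and without precoloured vertices\<close>

definition P :: "int set" where
  "P = {v \<in> V. \<not> X v \<and> (\<exists>u\<in>V. clique v u \<and> p u \<noteq> 0)}"

definition N :: "int set" where
  "N = {v \<in> V. \<not> X v \<and> (\<forall>u\<in>V. clique v u \<longrightarrow> p u = 0)}"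

text \<open>Two groups may receive the same colour: then the sets \<open>A j a\<close> below still are disjoint, so
  the colours of the groups can be chosen independently of each other.\<close>

lemma card_P: "card (S \<inter> P) \<le> card (T \<inter> P)"
proof -
  define J where "J = g ` {x \<in> V. X x}"
  define rep where "rep j = (SOME x. x \<in> V \<and> X x \<and> g x = j)" for j
  define A where "A j a = {v \<in> V. \<not> X v \<and> clique_precoloured v a \<and> (\<exists>x\<in>V. bound v x) \<and>
      inside v j}" for j a
  \<comment> \<open>Vertices without bound vertices are inside every group, so they would destroy
    the disjointness and are counted separately.\<close>
  define Z where "Z = {v \<in> S \<inter> P. \<forall>x\<in>V. \<not> bound v x}"
  have rep: "rep j \<in> V \<and> X (rep j) \<and> g (rep j) = j" if "j \<in> J" for j
  proof -
    have "\<exists>x. x \<in> V \<and> X x \<and> g x = j" using that by (auto simp: J_def)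
    then show ?thesis unfolding rep_def by (rule someI_ex)
  qed
  have fin: "finite J" "finite (A j a)" "finite Z" "finite P" for j a
    using finite_ST by (simp_all add: J_def A_def Z_def P_def)
  have sub: "S \<inter> P \<subseteq> Z \<union> (\<Union>j\<in>J. A j (cs (rep j)))"
  proof
    fix v assume v: "v \<in> S \<inter> P"
    show "v \<in> Z \<union> (\<Union>j\<in>J. A j (cs (rep j)))"
    proof (cases "\<forall>x\<in>V. \<not> bound v x")
      case False
      then obtain x where x: "x \<in> V" "bound v x" by blast
      have vS: "v \<in> S" "v \<in> V" "\<not> X v" using v by (auto simp: P_def)
      have Xx: "X x" using x by (simp add: bound_def)
      have J: "g x \<in> J" using x Xx by (auto simp: J_def)
      have cx: "cs x = cs v" using S_bound[OF vS(1,3) x] .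
      have "cs (rep (g x)) = cs v" using rep[OF J] g_eq_iff x(1) Xx cx by metis
      moreover have "inside v (g x)" unfolding inside_def
      proof (intro ballI impI)
        fix y assume y: "y \<in> V" "bound v y"
        have "X y" using y by (simp add: bound_def)
        then show "g y = g x" using S_bound[OF vS(1,3) y] cx g_eq_iff y(1) x(1) Xx by simp
      qed
      moreover have "clique_precoloured v (cs v)" using v S_precoloured by (auto simp: P_def)
      ultimately have "v \<in> A (g x) (cs (rep (g x)))" using vS x by (auto simp: A_def)
      then show ?thesis using J by blast
    qed (use v in \<open>simp add: Z_def\<close>)
  qed
  have sub': "Z \<union> (\<Union>j\<in>J. A j (group_colour j)) \<subseteq> T \<inter> P"
  proof (intro Un_least UN_least subsetI IntI)
    fix v assume "v \<in> Z"
    then have v: "v \<in> S" "v \<in> P" "\<forall>x\<in>V. \<not> bound v x" by (auto simp: Z_def)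
    then show "v \<in> P" by simp
    have "clique_precoloured v (cs v)" using v S_precoloured by (auto simp: P_def)
    then show "v \<in> T" using v precoloured_happy[of v "cs v"] by (auto simp: P_def)
  next
    fix j v assume "j \<in> J" "v \<in> A j (group_colour j)"
    then have v: "v \<in> V" "\<not> X v" "clique_precoloured v (group_colour j)" "inside v j"
        by (auto simp: A_def)
    then show "v \<in> P" by (auto simp: P_def clique_precoloured_def)
    show "v \<in> T" using precoloured_happy[OF v(1-3)] v(4) by (simp add: inside_def)
  qed
  have le: "card (A j (cs (rep j))) \<le> card (A j (group_colour j))" if "j \<in> J" for j
    using weight_group_colour[of "rep j"] rep[OF that] unfolding weight_card A_def by simp
  have "card (S \<inter> P) \<le> card (Z \<union> (\<Union>j\<in>J. A j (cs (rep j))))"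
    using sub fin by (intro card_mono) auto
  also have "\<dots> \<le> card Z + card (\<Union>j\<in>J. A j (cs (rep j)))" by (rule card_Un_le)
  also have "card (\<Union>j\<in>J. A j (cs (rep j))) \<le> (\<Sum>j\<in>J. card (A j (cs (rep j))))"
    using fin(1) by (rule card_UN_le)
  also have "(\<Sum>j\<in>J. card (A j (cs (rep j)))) \<le> (\<Sum>j\<in>J. card (A j (group_colour j)))"
    using le by (rule sum_mono)
  \<comment> \<open>Equality is needed on this side. It holds since a member of \<open>A j a\<close>
    has a bound vertex, which lies in group \<open>j\<close> and in no other; for \<open>cs\<close>
    the union bound was enough.\<close>
  also have "\<dots> = card (\<Union>j\<in>J. A j (group_colour j))"
    using fin by (intro card_UN_disjoint[symmetric]) (auto simp: A_def inside_def)
  also have "card Z + \<dots> = card (Z \<union> (\<Union>j\<in>J. A j (group_colour j)))"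
    using fin by (intro card_Un_disjoint[symmetric]) (auto simp: A_def Z_def)
  also have "\<dots> \<le> card (T \<inter> P)" using sub' fin by (intro card_mono) auto
  finally show ?thesis by simp
qed

text \<open>The vertices of the clique that are happy under \<open>cs\<close> have one colour, so
  their bound vertices lie in one group \<open>j\<close>. The computed colouring makes every vertex
  of the clique happy that is inside the group of largest score.\<close>

lemma card_clique:
  assumes v: "v \<in> N"
  shows "card (S \<inter> {u \<in> V. clique v u}) \<le> card (T \<inter> {u \<in> V. clique v u})"
proof (cases "S \<inter> {u \<in> V. clique v u} = {}")
  case False
  then obtain s where s: "s \<in> S" "s \<in> V" "clique v s" by auto
  have vV: "v \<in> V" "\<not> X v" "\<And>u. u \<in> V \<Longrightarrow> clique v u \<Longrightarrow> p u = 0" using v by (auto simp: N_def)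
  have n: "0 < n + 1" using vV by auto
  have sX: "\<not> X s" using s by (simp add: clique_def)
  \<comment> \<open>At most one group has the colour of \<open>s\<close>. If there is none, the
    condition on \<open>j\<close> is vacuous and the spare index \<open>n\<close> is taken.\<close>
  obtain j where j: "j \<in> {0..<n + 1}" "\<And>x. x \<in> V \<Longrightarrow> X x \<Longrightarrow> cs x = cs s \<Longrightarrow> g x = j"
  proof (cases "\<exists>x\<in>V. X x \<and> cs x = cs s")
    case True
    then obtain x where x: "x \<in> V" "X x" "cs x = cs s" by blast
    show ?thesis
    proof (rule that[of "g x"])
      show "g x \<in> {0..<n + 1}" using g_range[OF x(1,2)] by simp
    qed (use g_eq_iff x in simp)
  next
    case False
    then show ?thesis using that[of n] n by auto
  qed
  define b where "b = best_group v"
  have b: "score v j \<le> score v b"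
    unfolding b_def best_group_def by (rule search_argmax(2)[OF n j(1)])
  have ce: "clique u w \<longleftrightarrow> clique v w" if "u \<in> V" "clique v u" "w \<in> V" for u w
    using clique_eq[OF vV(1) that(1,3) vV(2) that(2)] .
  have "S \<inter> {u \<in> V. clique v u} \<subseteq> {u \<in> V. clique v u \<and> inside u j}"
  proof safe
    fix u assume u: "u \<in> S" "u \<in> V" "clique v u"
    have uX: "\<not> X u" using u by (simp add: clique_def)
    have "clique s u" using ce[OF s(2,3) u(2)] u(3) by simp
    then have "cs u = cs s" using S_clique[OF s(1) u(2)] by simp
    then show "inside u j"
      unfolding inside_def using S_bound[OF u(1) uX] j(2) by (simp add: bound_def)
  qed
  then have "card (S \<inter> {u \<in> V. clique v u}) \<le> card {u \<in> V. clique v u \<and> inside u j}"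
    by (intro card_mono) auto
  also have "int \<dots> = score v j" unfolding score_def by (rule sum_of_bool_card[symmetric]) simp
  also note b
  also have "score v b = int (card {u \<in> V. clique v u \<and> inside u b})"
    unfolding score_def by (rule sum_of_bool_card) simp
  also have "card {u \<in> V. clique v u \<and> inside u b} \<le> card (T \<inter> {u \<in> V. clique v u})"
  proof (rule card_mono[OF _ subsetI])
    show "finite (T \<inter> {u \<in> V. clique v u})" using finite_ST by simp
    fix u assume "u \<in> {u \<in> V. clique v u \<and> inside u b}"
    then have u: "u \<in> V" "clique v u" "inside u b" by auto
    have uX: "\<not> X u" using u by (simp add: clique_def)
    have "u \<in> T"
    proof (rule happy_if[OF u(1) uX])
      fix x assume "x \<in> V" "X x" "E u x"
      then show "colour x = group_colour b" using u(3) by (simp add: inside_def colour_def bound_def)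
    next
      fix w assume w: "w \<in> V" "clique u w"
      then have vw: "clique v w" using ce[OF u(1,2)] by blast
      have wX: "\<not> X w" using w by (simp add: clique_def)
      \<comment> \<open>A happy neighbour of \<open>w\<close> is bound to \<open>u\<close> as well,
        because both lie in one clique. So a single vertex inside group \<open>b\<close> already
        gives the whole clique the colour of \<open>b\<close>.\<close>
      from search_H[OF w(1) wX vV(3)[OF w(1) vw]] show "colour w = group_colour b"
      proof cases
        case (1 h)
        then have "bound u h" using w H_D(1) unfolding bound_def by blast
        then show ?thesis using 1 u(3) by (simp add: inside_def)
      next
        case 2
        \<comment> \<open>The clique colour is computed separately at each vertex; the scores agree
          along the clique, hence so do the chosen groups.\<close>
        have "score w i = score v i" for i
          unfolding score_def using ce[OF w(1) vw] by (intro sum.cong) auto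
        then have bw: "best_group w = b" by (simp add: best_group_def b_def)
        from search_precoloured[of w] show ?thesis
        proof cases
          case (1 u')
          then show ?thesis using vV(3) ce[OF w(1) vw] by blast
        next
          case 2
          then show ?thesis using bw \<open>colour w = clique_colour w\<close> by simp
        qed
      qed
    qed
    then show "u \<in> T \<inter> {u \<in> V. clique v u}" using u by simp
  qed
  finally show ?thesis by simp
qed simp

lemma card_N: "card (S \<inter> N) \<le> card (T \<inter> N)"
proof -
  define K where "K = (\<lambda>v. {u \<in> V. clique v u}) ` N"
  have fin: "finite K" by (simp add: K_def N_def)
  have UK: "\<Union>K = N"
  proof
    show "N \<subseteq> \<Union>K" by (auto simp: K_def N_def clique_def)
    show "\<Union>K \<subseteq> N"
    proof
      fix u assume "u \<in> \<Union>K"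
      then obtain v where v: "v \<in> N" "u \<in> V" "clique v u" by (auto simp: K_def)
      then show "u \<in> N" using clique_eq[of v u] by (auto simp: N_def clique_def[of v u])
    qed
  qed
  have disj: "C = D" if "C \<in> K" "D \<in> K" "C \<inter> D \<noteq> {}" for C D
  proof -
    obtain v w where vw: "v \<in> N" "w \<in> N" "C = {u \<in> V. clique v u}" "D = {u \<in> V. clique w u}"
      using \<open>C \<in> K\<close> \<open>D \<in> K\<close> unfolding K_def by blast
    then obtain u where u: "u \<in> V" "clique v u" "clique w u" using \<open>C \<inter> D \<noteq> {}\<close> by blast
    then have "clique v y \<longleftrightarrow> clique w y" if "y \<in> V" for y
      using clique_eq[of v u y] clique_eq[of w u y] u vw(1,2) that by (auto simp: N_def)
    then show ?thesis using vw(3,4) by auto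
  qed
  have "card (S \<inter> N) = card (\<Union>C\<in>K. S \<inter> C)" using UK by (metis Int_Union)
  also have "\<dots> \<le> (\<Sum>C\<in>K. card (S \<inter> C))" using fin by (rule card_UN_le)
  also have "\<dots> \<le> (\<Sum>C\<in>K. card (T \<inter> C))" using card_clique by (intro sum_mono) (auto simp: K_def)
  also have "\<dots> = card (\<Union>C\<in>K. T \<inter> C)"
  proof (intro card_UN_disjoint[symmetric] ballI impI)
    show "finite (T \<inter> C)" for C by (simp add: T_def)
    show "(T \<inter> C) \<inter> (T \<inter> D) = {}" if "C \<in> K" "D \<in> K" "C \<noteq> D" for C D using disj that by blast
  qed (rule fin)
  also have "\<dots> = card (T \<inter> N)" using UK by (metis Int_Union)
  finally show ?thesis .
qed

theorem good_card: "good l (int (card S))"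
proof -
  note fin = finite_ST
  have split: "card B = card (B \<inter> {x. X x}) + card (B \<inter> P) + card (B \<inter> N)" if "B \<subseteq> V" for B
  proof -
    have f: "finite B" using that finite_subset by blast
    have "B = (B \<inter> {x. X x}) \<union> (B \<inter> P) \<union> (B \<inter> N)" using that by (auto simp: P_def N_def)
    then have "card B = card ((B \<inter> {x. X x}) \<union> (B \<inter> P) \<union> (B \<inter> N))" by simp
    also have "\<dots> = card ((B \<inter> {x. X x}) \<union> (B \<inter> P)) + card (B \<inter> N)"
      using f by (intro card_Un_disjoint) (auto simp: P_def N_def)
    also have "card ((B \<inter> {x. X x}) \<union> (B \<inter> P)) = card (B \<inter> {x. X x}) + card (B \<inter> P)"
      using f by (intro card_Un_disjoint) (auto simp: P_def N_def)
    finally show ?thesis .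
  qed
  have "S \<inter> {x. X x} \<subseteq> T \<inter> {x. X x}" using H_happy H_iff by (auto simp: S_def)
  then have "card (S \<inter> {x. X x}) \<le> card (T \<inter> {x. X x})" using fin by (intro card_mono) auto
  moreover have "S \<subseteq> V" "T \<subseteq> V" by (auto simp: S_def T_def)
  ultimately have "card S \<le> card T"
    using split[of S] split[of T] card_P card_N by linarith
  moreover have "(\<Sum>v\<in>V. of_bool (\<forall>u\<in>V. E u v \<longrightarrow> colour u = colour v)) = int (card T)"
    unfolding T_def by (rule sum_of_bool_card) simp
  ultimately show ?thesis unfolding good_def using colour_legal by simp
qed

end

section \<open>Decoding a guess and computing its completion\<close>

definition precolour :: "memory \<Rightarrow> int \<Rightarrow> int" where
  "precolour M u = M (max 0 (3 + u))"

text \<open>Digits are addressed by the position of a vertex within the coded set. This is why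
  \<open>d\<close> digits suffice and there are only \<open>(2 * d) ^ d\<close> codes.\<close>

definition rank :: "memory \<Rightarrow> int \<Rightarrow> int \<Rightarrow> int" where
  "rank M m x = (\<Sum>y\<in>{0..<M 0}. of_bool (y < x \<and> mem M m y))"

text \<open>The digit of the code \<open>c\<close> that belongs to \<open>x\<close> lies below \<open>2 * d\<close>: it is the group of \<open>x\<close>, plus \<open>d\<close>
  if \<open>x\<close> is guessed to be happy.\<close>

definition label :: "memory \<Rightarrow> int \<Rightarrow> int \<Rightarrow> int \<Rightarrow> int \<Rightarrow> int" where
  "label M m d c x = digit M (2 * d) c (rank M m x)"

definition group_of :: "memory \<Rightarrow> int \<Rightarrow> int \<Rightarrow> int \<Rightarrow> int \<Rightarrow> int" where
  "group_of M m d c x = (if label M m d c x < d then label M m d c x else label M m d c x - d)"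

definition to_be_happy :: "memory \<Rightarrow> int \<Rightarrow> int \<Rightarrow> int \<Rightarrow> int \<Rightarrow> bool" where
  "to_be_happy M m d c x \<longleftrightarrow> mem M m x \<and> d \<le> label M m d c x"

lemma poly_precolour [poly_intros]: "poly_computable a \<Longrightarrow> poly_computable (\<lambda>M v. precolour M (a M v))"
  by (rule poly_subst1[where h = precolour]) (unfold precolour_def, intro poly_intros)

lemma poly_rank [poly_intros]: "poly_computable a \<Longrightarrow> poly_computable b \<Longrightarrow>
    poly_computable (\<lambda>M v. rank M (a M v) (b M v))"
  by (rule poly_subst2[where h = rank]) (unfold rank_def, intro poly_intros)

lemma poly_label [poly_intros]: "poly_computable a \<Longrightarrow> poly_computable b \<Longrightarrow> poly_computable c \<Longrightarrow>
    poly_computable d \<Longrightarrow>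
    poly_computable (\<lambda>M v. label M (a M v) (b M v) (c M v) (d M v))"
  by (rule poly_subst4[where h = label]) (unfold label_def, intro poly_intros)

lemma poly_group_of [poly_intros]: "poly_computable a \<Longrightarrow> poly_computable b \<Longrightarrow> poly_computable c \<Longrightarrow>
    poly_computable d \<Longrightarrow>
    poly_computable (\<lambda>M v. group_of M (a M v) (b M v) (c M v) (d M v))"
  by (rule poly_subst4[where h = group_of]) (unfold group_of_def, intro poly_intros)

lemma poly_to_be_happy [poly_intros]: "poly_computable a \<Longrightarrow> poly_computable b \<Longrightarrow>
    poly_computable c \<Longrightarrow> poly_computable d \<Longrightarrow>
    poly_decidable (\<lambda>M v. to_be_happy M (a M v) (b M v) (c M v) (d M v))"
  by (rule poly_subst4[where h = "\<lambda>M m d c x. of_bool (to_be_happy M m d c x)"])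
     (unfold to_be_happy_def, intro poly_intros)

interpretation G: guess "M 0" "adj M" "precolour M" "mem M m" "to_be_happy M m d c" "group_of M m d c"
  for M m d c .

lemma poly_clique [poly_intros]: "poly_computable a \<Longrightarrow> poly_computable b \<Longrightarrow> poly_computable c \<Longrightarrow>
    poly_decidable (\<lambda>M v. G.clique M (a M v) (b M v) (c M v))"
  by (rule poly_subst3[where h = "\<lambda>M m u w. of_bool (G.clique M m u w)"])
     (unfold G.clique_def, intro poly_intros)

lemma poly_bound [poly_intros]: "poly_computable a \<Longrightarrow> poly_computable b \<Longrightarrow> poly_computable c \<Longrightarrow>
    poly_computable d \<Longrightarrow> poly_computable e \<Longrightarrow>
    poly_decidable (\<lambda>M v. G.bound M (a M v) (b M v) (c M v) (d M v) (e M v))"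
  by (rule poly_subst5[where h = "\<lambda>M m d c u w. of_bool (G.bound M m d c u w)"])
     (unfold G.bound_def, intro poly_intros)

lemma poly_inside [poly_intros]: "poly_computable a \<Longrightarrow> poly_computable b \<Longrightarrow> poly_computable c \<Longrightarrow>
    poly_computable d \<Longrightarrow> poly_computable e \<Longrightarrow>
    poly_decidable (\<lambda>M v. G.inside M (a M v) (b M v) (c M v) (d M v) (e M v))"
  by (rule poly_subst5[where h = "\<lambda>M m d c u w. of_bool (G.inside M m d c u w)"])
     (unfold G.inside_def, intro poly_intros)

lemma poly_clique_precoloured [poly_intros]: "poly_computable a \<Longrightarrow> poly_computable b \<Longrightarrow>
    poly_computable c \<Longrightarrow>
    poly_decidable (\<lambda>M v. G.clique_precoloured M (a M v) (b M v) (c M v))"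
  by (rule poly_subst3[where h = "\<lambda>M m u w. of_bool (G.clique_precoloured M m u w)"])
     (unfold G.clique_precoloured_def, intro poly_intros)

lemma poly_weight [poly_intros]: "poly_computable a \<Longrightarrow> poly_computable b \<Longrightarrow> poly_computable c \<Longrightarrow>
    poly_computable d \<Longrightarrow> poly_computable e \<Longrightarrow>
    poly_computable (\<lambda>M v. G.weight M (a M v) (b M v) (c M v) (d M v) (e M v))"
  by (rule poly_subst5[where h = "\<lambda>M m d c u w. G.weight M m d c u w"])
     (unfold G.weight_def, intro poly_intros)

lemma poly_candidate [poly_intros]: "poly_computable a \<Longrightarrow>
    poly_computable (\<lambda>M v. G.candidate M (a M v))"
  by (rule poly_subst1[where h = "\<lambda>M y. G.candidate M y"]) (unfold G.candidate_def, intro poly_intros)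

lemma poly_forces [poly_intros]: "poly_computable a \<Longrightarrow> poly_computable b \<Longrightarrow> poly_computable c \<Longrightarrow>
    poly_computable d \<Longrightarrow> poly_computable e \<Longrightarrow>
    poly_decidable (\<lambda>M v. G.forces M (a M v) (b M v) (c M v) (d M v) (e M v))"
  by (rule poly_subst5[where h = "\<lambda>M m d c u w. of_bool (G.forces M m d c u w)"])
     (unfold G.forces_def, intro poly_intros)

lemma poly_best_candidate [poly_intros]: "poly_computable a \<Longrightarrow> poly_computable b \<Longrightarrow>
    poly_computable c \<Longrightarrow> poly_computable d \<Longrightarrow>
    poly_computable (\<lambda>M v. G.best_candidate M (a M v) (b M v) (c M v) (d M v))"
  by (rule poly_subst4[where h = "\<lambda>M m d c j. G.best_candidate M m d c j"])
     (unfold G.best_candidate_def, intro poly_intros)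

lemma poly_group_colour [poly_intros]: "poly_computable a \<Longrightarrow> poly_computable b \<Longrightarrow>
    poly_computable c \<Longrightarrow> poly_computable d \<Longrightarrow>
    poly_computable (\<lambda>M v. G.group_colour M (a M v) (b M v) (c M v) (d M v))"
  by (rule poly_subst4[where h = "\<lambda>M m d c j. G.group_colour M m d c j"])
     (unfold G.group_colour_def, intro poly_intros)

lemma poly_score [poly_intros]: "poly_computable a \<Longrightarrow> poly_computable b \<Longrightarrow> poly_computable c \<Longrightarrow>
    poly_computable d \<Longrightarrow> poly_computable e \<Longrightarrow>
    poly_computable (\<lambda>M v. G.score M (a M v) (b M v) (c M v) (d M v) (e M v))"
  by (rule poly_subst5[where h = "\<lambda>M m d c u w. G.score M m d c u w"])
     (unfold G.score_def, intro poly_intros)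

lemma poly_best_group [poly_intros]: "poly_computable a \<Longrightarrow> poly_computable b \<Longrightarrow> poly_computable c \<Longrightarrow>
    poly_computable d \<Longrightarrow>
    poly_computable (\<lambda>M v. G.best_group M (a M v) (b M v) (c M v) (d M v))"
  by (rule poly_subst4[where h = "\<lambda>M m d c u. G.best_group M m d c u"])
     (unfold G.best_group_def, intro poly_intros)

lemma poly_clique_colour [poly_intros]: "poly_computable a \<Longrightarrow> poly_computable b \<Longrightarrow>
    poly_computable c \<Longrightarrow> poly_computable d \<Longrightarrow>
    poly_computable (\<lambda>M v. G.clique_colour M (a M v) (b M v) (c M v) (d M v))"
  by (rule poly_subst4[where h = "\<lambda>M m d c u. G.clique_colour M m d c u"])
     (unfold G.clique_colour_def, intro poly_intros)

lemma poly_colour [poly_intros]: "poly_computable a \<Longrightarrow> poly_computable b \<Longrightarrow> poly_computable c \<Longrightarrow>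
    poly_computable d \<Longrightarrow>
    poly_computable (\<lambda>M v. G.colour M (a M v) (b M v) (c M v) (d M v))"
  by (rule poly_subst4[where h = "\<lambda>M m d c u. G.colour M m d c u"])
     (unfold G.colour_def, intro poly_intros)

lemma poly_registers [poly_intros]: "poly_computable (\<lambda>M v. M 1)" "poly_computable (\<lambda>M v. M 2)"
  using computable_read[OF computable_num[of 1]] computable_read[OF computable_num[of 2]] by simp_all

abbreviation accepts :: "memory \<Rightarrow> int \<Rightarrow> int \<Rightarrow> int \<Rightarrow> bool" where
  "accepts M m d c \<equiv> G.good M m d c (M 1) (M 2)"

lemma poly_accepts [poly_intros]: "poly_computable a \<Longrightarrow> poly_computable b \<Longrightarrow> poly_computable c \<Longrightarrow>
    poly_decidable (\<lambda>M v. accepts M (a M v) (b M v) (c M v))"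
  by (rule poly_subst3[where h = "\<lambda>M m d c. of_bool (accepts M m d c)"])
     (unfold G.good_def, intro poly_intros)

section \<open>The exponential searches and their cost\<close>

definition solvable :: "memory \<Rightarrow> bool" where
  "solvable M \<longleftrightarrow> (\<exists>c\<in>{0..<pow M (2 * cluster_distance M) (cluster_distance M)}.
     accepts M (modulator M) (cluster_distance M) c)"

definition branchings :: "memory \<Rightarrow> nat" where
  "branchings M = (2 * nat (cluster_distance M)) ^ nat (cluster_distance M)"

definition admissible :: "memory \<Rightarrow> env \<Rightarrow> bool" where
  "admissible M v \<longleftrightarrow> 0 \<le> M 0 \<and> 0 \<le> cluster_distance M"

lemma admissible_le: "admissible M v \<Longrightarrow> cluster_distance M \<le> M 0"
  unfolding admissible_def cluster_distance_def
  using search_less[of "\<lambda>d. \<exists>c\<in>{0..<pow M 3 d}. hits M d c" "M 0 + 1"] by linarith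

lemma branchings_pos: "0 < branchings M"
  unfolding branchings_def by (cases "nat (cluster_distance M)") simp_all

text \<open>From \<open>d = 2\<close> on, the base 3 is at most \<open>2 * d\<close>. The factor 2
  pays for \<open>d = 1\<close>, where 3 exceeds 2; for \<open>d = 0\<close> both powers are
  1.\<close>

lemma pow3_le:
  assumes "admissible M v" "d \<le> cluster_distance M"
  shows "nat (pow M 3 d) \<le> 2 * branchings M"
proof -
  let ?k = "nat (cluster_distance M)"
  have "d \<le> M 0" "0 \<le> M 0" using admissible_le[OF assms(1)] assms by (simp_all add: admissible_def)
  then have "pow M 3 d = 3 ^ nat d" by (intro pow_eq) auto
  then have "nat (pow M 3 d) = 3 ^ nat d" by (simp add: nat_power_eq)
  also have "\<dots> \<le> 3 ^ ?k" using assms by (intro power_increasing) auto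
  also have "\<dots> \<le> 2 * (2 * ?k) ^ ?k"
  proof (cases "?k \<ge> 2")
    case True
    then have "(3::nat) ^ ?k \<le> (2 * ?k) ^ ?k" by (intro power_mono) auto
    then show ?thesis by simp
  next
    case False
    then have "?k = 0 \<or> ?k = 1" by auto
    then show ?thesis by (elim disjE) (simp_all only:, simp_all)
  qed
  finally show ?thesis by (simp add: branchings_def)
qed

lemma computable_lift: "poly_computable f \<Longrightarrow> (\<And>M v. A M v \<Longrightarrow> admissible M v) \<Longrightarrow>
    computable A branchings f"
  by (rule computable_const) (auto simp: branchings_pos)

text \<open>Trying \<open>d\<close> takes \<open>3 ^ d\<close> rounds, which
  \<open>branchings\<close> bounds for \<open>d\<close> up to the result of the search, and no
  larger \<open>d\<close> is evaluated. The outer loop contributes a polynomial factor.\<close>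

lemma computable_cluster_distance: "computable admissible branchings (\<lambda>M v. cluster_distance M)"
  unfolding cluster_distance_def
proof (rule computable_search[where FN = "\<lambda>_. 1" and FB = branchings and D = 3 and m = 1])
  show "computable admissible branchings (\<lambda>M v. M 0 + 1)"
    by (intro computable_lift poly_intros)
  let ?P = "\<lambda>M d. \<exists>c\<in>{0..<pow M 3 d}. hits M d c"
  let ?A = "\<lambda>M v. admissible M (\<lambda>j. v (Suc j)) \<and> 0 \<le> v 0 \<and> v 0 < M 0 + 1 \<and> (\<forall>i\<in>{0..<v 0}. \<not> ?P M i)"
  have A: "v 0 \<le> cluster_distance M" if "?A M v" for M and v :: env
  proof -
    have "0 \<le> cluster_distance M" using that by (simp add: admissible_def)
    then have "?P M (cluster_distance M)" 
      using search_witness(2)[of _ "M 0 + 1" "?P M"] unfolding cluster_distance_def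
          search_ge_0_iff by blast
    then show ?thesis using that \<open>0 \<le> cluster_distance M\<close> by (meson atLeastLessThan_iff not_le)
  qed
  have s: "computable ?A branchings (\<lambda>M v. search (hits M (v 0)) (pow M 3 (v 0)))"
  proof (rule computable_search[where FN = branchings and FB = "\<lambda>_. 1" and D = 2 and m = 0])
    show "computable ?A branchings (\<lambda>M v. pow M 3 (v 0))"
      by (rule computable_lift) (intro poly_intros, simp add: admissible_def)
    show "nat (pow M 3 (v 0)) \<le> 2 * branchings M * msize M ^ 0" if "?A M v" for M v
      using pow3_le[of M _ "v 0"] A[OF that] that by auto
  qed (rule poly_weaken, intro poly_intros, auto)
  have "computable ?A branchings (\<lambda>M v. of_bool (0 \<le> search (hits M (v 0)) (pow M 3 (v 0))))"
    by (rule computable_bind[OF s, where B = admissible and f = "\<lambda>M v x. of_bool (0 \<le> x)"])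
      (rule computable_lift, intro poly_intros, simp_all add: admissible_def)
  then show "computable ?A branchings (\<lambda>M v. of_bool (?P M (v 0)))"
    unfolding search_ge_0_iff .
qed (auto simp: branchings_pos msize_def)

lemma computable_modulator: "computable admissible branchings (\<lambda>M v. modulator M)"
  unfolding modulator_def
proof (rule computable_bind[OF computable_cluster_distance, where f =
    "\<lambda>M v d. mask M d (search (hits M d) (pow M 3 d))"])
  let ?B = "\<lambda>M v. admissible M v \<and> v 0 = cluster_distance M"
  have s: "computable ?B branchings (\<lambda>M v. search (hits M (v 0)) (pow M 3 (v 0)))"
  proof (rule computable_search[where FN = branchings and FB = "\<lambda>_. 1" and D = 2 and m = 0])
    show "computable ?B branchings (\<lambda>M v. pow M 3 (v 0))"
      by (rule computable_lift) (intro poly_intros, simp)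
    show "nat (pow M 3 (v 0)) \<le> 2 * branchings M * msize M ^ 0" if "?B M v" for M v
      using pow3_le[of M v "v 0"] that by auto
  qed (rule poly_weaken, intro poly_intros, auto)
  show "computable ?B branchings (\<lambda>M v. mask M (v 0) (search (hits M (v 0)) (pow M 3 (v 0))))"
    by (rule computable_bind[OF s, where B = admissible and f = "\<lambda>M v c. mask M (v 0) c"])
      (rule computable_lift, intro poly_intros, simp_all add: admissible_def)
qed (simp_all add: admissible_def)

text \<open>The domains \<open>?B\<close> and \<open>?C\<close> record that a variable holds
  \<open>cluster_distance M\<close>. For an arbitrary value \<open>d\<close> of this variable,
  \<open>branchings\<close> would not bound the \<open>pow M (2 * d) d\<close> rounds.\<close>

lemma computable_solvable: "computable admissible branchings (\<lambda>M v. of_bool (solvable M))"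
proof -
  let ?s = "\<lambda>M m d. search (accepts M m d) (pow M (2 * d) d)"
  let ?B = "\<lambda>M v. admissible M v \<and> v 0 = cluster_distance M"
  let ?C = "\<lambda>M v. admissible M v \<and> v (Suc 0) = cluster_distance M"
  have s: "computable ?C branchings (\<lambda>M v. ?s M (v 0) (v (Suc 0)))"
  proof (rule computable_search[where FN = branchings and FB = "\<lambda>_. 1" and D = 1 and m = 0])
    show "computable ?C branchings (\<lambda>M v. pow M (2 * v (Suc 0)) (v (Suc 0)))"
      by (rule computable_lift) (intro poly_intros, simp)
    show "nat (pow M (2 * v (Suc 0)) (v (Suc 0))) \<le> 1 * branchings M * msize M ^ 0" if "?C M v"
        for M v
    proof -
      let ?d = "cluster_distance M"
      have d: "0 \<le> ?d" "?d \<le> M 0" using that admissible_le by (simp_all add: admissible_def)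
      then have "pow M (2 * ?d) ?d = (2 * ?d) ^ nat ?d" by (intro pow_eq) auto
      then show ?thesis using that d by (simp add: branchings_def nat_power_eq nat_mult_distrib)
    qed
  qed (rule poly_weaken, intro poly_intros, auto)
  have c: "computable ?C branchings (\<lambda>M v. of_bool (0 \<le> ?s M (v 0) (v (Suc 0))))"
    by (rule computable_bind[OF s, where B = admissible and f = "\<lambda>M v x. of_bool (0 \<le> x)"])
        (rule computable_lift, intro poly_intros, simp_all add: admissible_def)
  have m: "computable ?B branchings (\<lambda>M v. modulator M)"
    by (rule computable_mono[OF computable_modulator, where D = 1]) (simp_all add: branchings_pos)
  have "computable ?B branchings (\<lambda>M v. of_bool (0 \<le> ?s M (modulator M) (v 0)))"
    by (rule computable_bind[OF m, where B = ?C and f = "\<lambda>M v m. of_bool (0 \<le> ?s M m (v 0))"])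
      (use c in \<open>simp_all add: admissible_def\<close>)
  then have "computable admissible branchings (\<lambda>M v. of_bool (0 \<le> ?s M (modulator M)
      (cluster_distance M)))"
    by (rule computable_bind[OF computable_cluster_distance, where f =
        "\<lambda>M v d. of_bool (0 \<le> ?s M (modulator M) d)"])
      (simp_all add: admissible_def)
  then show ?thesis unfolding search_ge_0_iff solvable_def .
qed

section \<open>Correctness and running time\<close>

text \<open>The colours that \<open>cs\<close> uses on the deletion set are numbered; there are at
  most \<open>d\<close> of them, so \<open>d\<close> group numbers suffice. Together with the
  happiness under \<open>cs\<close>, these numbers form the digits of a right guess.\<close>

lemma happy_guess:
  assumes m: "is_mask M m" and d: "card (members M m) \<le> nat d" "0 \<le> d" "d \<le> M 0"
    and cl: "cluster_off M (members M m)"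
    and sym: "\<And>u v. u \<in> {0..<M 0} \<Longrightarrow> v \<in> {0..<M 0} \<Longrightarrow> adj M u v \<Longrightarrow> adj M v u"
    and cs_range: "\<And>v. v \<in> {0..<M 0} \<Longrightarrow> 1 \<le> cs v \<and> cs v \<le> M 1"
    and cs_extends: "\<And>v. v \<in> {0..<M 0} \<Longrightarrow> precolour M v \<noteq> 0 \<Longrightarrow> cs v = precolour M v"
    and k: "M 2 \<le> int (card {v \<in> {0..<M 0}. \<forall>u\<in>{0..<M 0}. adj M u v \<longrightarrow> cs u = cs v})"
  shows "\<exists>c\<in>{0..<pow M (2 * d) d}. accepts M m d c"
proof -
  define X where "X = members M m"
  have fX: "finite X" unfolding X_def by (rule finite_members)
  have X: "X \<subseteq> {0..<M 0}" "\<And>x. x \<in> {0..<M 0} \<Longrightarrow> mem M m x \<longleftrightarrow> x \<in> X" by (auto simp: X_def members_def)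
  define hs where "hs v \<longleftrightarrow> (\<forall>u\<in>{0..<M 0}. adj M u v \<longrightarrow> cs u = cs v)" for v
  have "card (cs ` X) \<le> card {0..<d}" using card_image_le[OF fX, of cs] d by (simp add: X_def)
  then obtain f where f: "f ` cs ` X \<subseteq> {0..<d}" "inj_on f (cs ` X)"
    using card_le_inj[of "cs ` X" "{0..<d}"] fX by auto
  have fd: "0 \<le> f (cs x) \<and> f (cs x) < d" if "x \<in> X" for x
    using f(1) that by (simp add: image_subset_iff)
  define lab where "lab x = f (cs x) + (if hs x then d else 0)" for x
  have rank: "rank M m x = int (card {y \<in> X. y < x})" for x
  proof -
    have "rank M m x = int (card {y \<in> {0..<M 0}. y < x \<and> mem M m y})"
      unfolding rank_def by (rule sum_of_bool_card) simp
    also have "{y \<in> {0..<M 0}. y < x \<and> mem M m y} = {y \<in> X. y < x}" using X by auto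
    finally show ?thesis .
  qed
  have rank_less: "rank M m x < rank M m y" if "x \<in> X" "y \<in> X" "x < y" for x y
    unfolding rank of_nat_less_iff
    by (rule psubset_card_mono) (use that fX in \<open>auto intro: less_trans\<close>)
  have rank_bound: "0 \<le> rank M m x \<and> rank M m x < d" if "x \<in> X" for x
  proof -
    have "card {y \<in> X. y < x} < card X" by (rule psubset_card_mono) (use that fX in auto)
    then show ?thesis using d by (simp add: rank X_def)
  qed
  \<comment> \<open>Ranks are pairwise different, so the vertex of a given rank is unique. The set
    may have fewer than \<open>d\<close> elements; the digits beyond its size are 0.\<close>
  define digs where "digs i = (if \<exists>x\<in>X. rank M m x = int i then lab (THE x. x \<in> X \<and> rank M m x =
      int i) else 0)" for i
  have digs_rank: "digs (nat (rank M m x)) = lab x" if "x \<in> X" for x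
  proof -
    have "(THE y. y \<in> X \<and> rank M m y = rank M m x) = x"
      using that rank_less by (intro the_equality) (metis linorder_neqE less_irrefl)+
    then show ?thesis using that rank_bound[OF that] by (auto simp: digs_def)
  qed
  have lab: "0 \<le> lab x \<and> lab x < 2 * d" if "x \<in> X" for x
    using fd[OF that] by (simp add: lab_def)
  have digs: "0 \<le> digs i \<and> digs i < 2 * d" if "i < nat d" for i
  proof (cases "\<exists>x\<in>X. rank M m x = int i")
    case True
    then obtain x where "x \<in> X" "rank M m x = int i" by blast
    then show ?thesis using digs_rank[of x] lab[of x] by simp
  next
    case False
    then show ?thesis using that by (simp add: digs_def)
  qed
  obtain c where "0 \<le> c \<and> c < (2 * d) ^ nat d \<and> (\<forall>i<nat d. c div (2 * d) ^ i mod (2 * d) = digs i)"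
    using digits_exist[of "nat d" digs "2 * d", OF digs] by blast
  then have c: "0 \<le> c" "c < (2 * d) ^ nat d" "\<And>i. i < nat d \<Longrightarrow> c div (2 * d) ^ i mod (2 * d) = digs i"
    by simp_all
  have label: "label M m d c x = lab x" if "x \<in> X" for x
  proof -
    have d1: "1 \<le> 2 * d" using rank_bound[OF that] by simp
    have "(2 * d) ^ nat d \<le> (2 * d) ^ nat (M 0)" using d d1 by (intro power_increasing) auto
    then have "c < (2 * d) ^ nat (M 0)" using c by linarith
    then have "label M m d c x = c div (2 * d) ^ nat (rank M m x) mod (2 * d)"
      unfolding label_def using d d1 rank_bound[OF that] c by (intro digit_eq) auto
    also have "\<dots> = lab x" using c(3) rank_bound[OF that] digs_rank[OF that] by simp
    finally show ?thesis .
  qed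
  have grp: "group_of M m d c x = f (cs x)" if "x \<in> X" for x
    using label[OF that] fd[OF that] by (auto simp: group_of_def lab_def)
  have hap: "to_be_happy M m d c x \<longleftrightarrow> x \<in> X \<and> hs x" if "x \<in> {0..<M 0}" for x
    using label[of x] fd[of x] X(2)[OF that]
    by (cases "x \<in> X") (simp_all add: to_be_happy_def lab_def)
  interpret right_guess "M 0" "adj M" "precolour M" "mem M m" "to_be_happy M m d c"
      "group_of M m d c" cs "M 1"
  proof
    show "adj M u w" if "u \<in> {0..<M 0}" "v \<in> {0..<M 0}" "w \<in> {0..<M 0}" "\<not> mem M m u"
        "\<not> mem M m v" "\<not> mem M m w"
      "adj M u v" "adj M v w" "u \<noteq> w" for u v w
      using cl that X(2) unfolding cluster_off_def X_def by blast
    show "to_be_happy M m d c x \<longleftrightarrow> mem M m x \<and> (\<forall>u\<in>{0..<M 0}. adj M u x \<longrightarrow> cs u = cs x)"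
      if "x \<in> {0..<M 0}" for x using hap[OF that] X(2)[OF that] by (simp add: hs_def)
    show "group_of M m d c x \<in> {0..<M 0}" if "x \<in> {0..<M 0}" "mem M m x" for x
      using that X(2) grp[of x] fd[of x] d by auto
    show "group_of M m d c x = group_of M m d c y \<longleftrightarrow> cs x = cs y"
      if "x \<in> {0..<M 0}" "y \<in> {0..<M 0}" "mem M m x" "mem M m y" for x y
      using that X(2) grp[of x] grp[of y] f(2) by (auto simp: inj_on_def)
  qed (use sym cs_range cs_extends in auto)
  have "accepts M m d c" using good_card k unfolding G.good_def S_def by linarith
  moreover have "pow M (2 * d) d = (2 * d) ^ nat d" using d by (intro pow_eq) auto
  ultimately show ?thesis using c by auto
qed

section \<open>The instance and its memory image\<close>

context
  fixes n l :: nat and G :: "nat pair_pre_digraph" and p :: "nat \<rightharpoonup> nat" and k :: int and M :: memory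
  assumes inst: "mhv_instance G l p" and verts: "pverts G = {..<n}"
  defines "M \<equiv> mhv_input n G l p k"
begin

lemma input_simps: "M (- 1) = 0" "M 0 = int n" "M 1 = int l" "M 2 = k"
  by (simp_all add: M_def mhv_input_def)

lemma vertexE:
  assumes "u \<in> {0..<M 0}"
  obtains u' where "u' < n" "u = int u'"
  using that[of "nat u"] assms by (simp add: input_simps nat_less_iff)

lemma input_precolour:
  assumes "u < n"
  shows "precolour M (int u) = (case p u of None \<Rightarrow> 0 | Some j \<Rightarrow> int j)"
  using assms by (simp add: precolour_def M_def mhv_input_def)

lemma input_adj:
  assumes "u < n" "v < n"
  shows "adj M (int u) (int v) \<longleftrightarrow> (u, v) \<in> parcs G"
proof -
  have "mul M (int u) (M 0) = int (u * n)" by (subst mul_eq) (simp_all add: input_simps)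
  then have "adj M (int u) (int v) \<longleftrightarrow> M (3 + int n + int (u * n + v)) = 1"
    by (simp add: adj_def input_simps add.assoc)
  moreover have "u * n + v < n * n"
  proof -
    have "u * n + v < Suc u * n" using assms by simp
    also have "\<dots> \<le> n * n" using assms by (intro mult_le_mono1) simp
    finally show ?thesis .
  qed
  then have "int (u * n + v) < int n * int n" by (metis of_nat_less_iff of_nat_mult)
  then have "M (3 + int n + int (u * n + v)) = (if (u, v) \<in> parcs G then 1 else 0)"
    using assms by (simp add: M_def mhv_input_def Let_def del: of_nat_add of_nat_mult)
  ultimately show ?thesis by simp
qed

lemma arcs_verts: "(u, v) \<in> parcs G \<Longrightarrow> u < n \<and> v < n"
proof -
  interpret pair_graph G using inst by (simp add: mhv_instance_def)
  show "(u, v) \<in> parcs G \<Longrightarrow> u < n \<and> v < n"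
    using in_arcsD1 in_arcsD2 verts by (metis lessThan_iff)
qed

lemma arcs_sym: "(u, v) \<in> parcs G \<Longrightarrow> (v, u) \<in> parcs G"
proof -
  interpret pair_graph G using inst by (simp add: mhv_instance_def)
  show "(u, v) \<in> parcs G \<Longrightarrow> (v, u) \<in> parcs G" by (rule arcs_symmetric)
qed

text \<open>Two blocks of the partition that share the middle vertex of a path coincide, so a
  minimum deletion set satisfies \<open>cluster_off\<close> and bounds the result of the
  search.\<close>

lemma distance_le: "0 \<le> cluster_distance M \<and> cluster_distance M \<le> int (distance_to_cluster G)"
proof -
  have "pair_graph G" using inst by (simp add: mhv_instance_def)
  from distance_to_cluster_attained[OF this] obtain X where
    X: "X \<subseteq> {..<n}" "card X = distance_to_cluster G" "cluster_graph (delete_verts G X)"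
    unfolding verts by blast
  from X(3) obtain \<C> where \<C>: "partition_on (pverts (delete_verts G X)) \<C>"
    "\<forall>u v. (u, v) \<in> parcs (delete_verts G X) \<longleftrightarrow> u \<noteq> v \<and> (\<exists>C\<in>\<C>. u \<in> C \<and> v \<in> C)"
    unfolding cluster_graph_def by blast
  have arc: "adj M (int u) (int v) \<longleftrightarrow> u \<noteq> v \<and> (\<exists>C\<in>\<C>. u \<in> C \<and> v \<in> C)"
    if "u < n" "v < n" "u \<notin> X" "v \<notin> X" for u v
    using \<C>(2)[rule_format, of u v] that by (simp add: input_adj delete_verts_def)
  have off: "adj M (int u) (int w)"
    if a: "u < n" "v < n" "w < n" "u \<notin> X" "v \<notin> X" "w \<notin> X" "adj M (int u) (int v)" "adj M (int v)
        (int w)" "u \<noteq> w"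
    for u v w
  proof -
    obtain C D where CD: "C \<in> \<C>" "D \<in> \<C>" "u \<in> C" "v \<in> C" "v \<in> D" "w \<in> D"
      using arc[of u v] arc[of v w] a by blast
    then have "C = D" using \<C>(1) unfolding partition_on_def disjoint_def by blast
    then show ?thesis using CD arc[of u w] a by blast
  qed
  have "cluster_off M (int ` X)"
    unfolding cluster_off_def
  proof (intro ballI impI)
    fix u v w
    assume a: "u \<in> {0..<M 0} - int ` X" "v \<in> {0..<M 0} - int ` X" "w \<in> {0..<M 0} - int ` X"
      "adj M u v \<and> adj M v w \<and> u \<noteq> w"
    then obtain u' v' w' where e: "u = int u'" "v = int v'" "w = int w'"
      using vertexE by (metis DiffD1)
    show "adj M u w" using a off[of u' v' w'] unfolding e by (auto simp: input_simps)
  qed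
  moreover have "int ` X \<subseteq> {0..<M 0}" using X(1) by (auto simp: input_simps)
  ultimately show ?thesis
    using cluster_distance_le[of "int ` X" M] X(2) by (simp add: input_simps card_image)
qed

lemma happy_card:
  assumes "\<And>v. v < n \<Longrightarrow> cs (int v) = int (c v)"
  shows "card {v \<in> {0..<M 0}. \<forall>u\<in>{0..<M 0}. adj M u v \<longrightarrow> cs u = cs v} =
      card {v \<in> pverts G. happy G c v}"
proof -
  have "happy G c v \<longleftrightarrow> (\<forall>u\<in>{0..<M 0}. adj M u (int v) \<longrightarrow> cs u = cs (int v))" if "v < n" for v
  proof
    assume h: "happy G c v"
    show "\<forall>u\<in>{0..<M 0}. adj M u (int v) \<longrightarrow> cs u = cs (int v)"
    proof (intro ballI impI)
      fix u assume u: "u \<in> {0..<M 0}" "adj M u (int v)"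
      then obtain u' where u': "u' < n" "u = int u'" using vertexE by blast
      then have "(u', v) \<in> parcs G" using u(2) input_adj that by simp
      then show "cs u = cs (int v)" using h assms u' that by (simp add: happy_def)
    qed
  next
    assume h: "\<forall>u\<in>{0..<M 0}. adj M u (int v) \<longrightarrow> cs u = cs (int v)"
    show "happy G c v" unfolding happy_def
    proof (intro allI impI)
      fix u assume u: "(u, v) \<in> parcs G"
      then have un: "u < n" using arcs_verts by blast
      then have "adj M (int u) (int v)" using u input_adj that by blast
      then show "c u = c v" using h un that assms by (auto simp: input_simps)
    qed
  qed
  then have "{v \<in> {0..<M 0}. \<forall>u\<in>{0..<M 0}. adj M u v \<longrightarrow> cs u = cs v} =
      int ` {v \<in> pverts G. happy G c v}"
    by (auto simp: verts input_simps elim!: vertexE[unfolded input_simps atLeastLessThan_iff, OF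
        conjI])
  then show ?thesis by (simp add: card_image)
qed

lemma solvable_iff: "solvable M \<longleftrightarrow> max_happy_vertices G l p k"
proof
  assume "solvable M"
  then obtain e where e: "accepts M (modulator M) (cluster_distance M) e" unfolding solvable_def
      by blast
  let ?col = "G.colour M (modulator M) (cluster_distance M) e"
  define c where "c v = nat (?col (int v))" for v
  have g: "\<And>v. v \<in> {0..<M 0} \<Longrightarrow> 1 \<le> ?col v \<and> ?col v \<le> M 1 \<and> (precolour M v \<noteq> 0 \<longrightarrow> ?col v =
      precolour M v)"
    "M 2 \<le> (\<Sum>v\<in>{0..<M 0}. of_bool (\<forall>u\<in>{0..<M 0}. adj M u v \<longrightarrow> ?col u = ?col v))"
    using e unfolding G.good_def by blast+
  have c: "?col (int v) = int (c v)" "1 \<le> c v" "c v \<le> l" if "v < n" for v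
    using g(1)[of "int v"] that by (auto simp: c_def input_simps)
  have "extends_colouring c p" unfolding extends_colouring_def
  proof
    fix v assume "v \<in> dom p"
    then obtain j where j: "p v = Some j" by blast
    then have v: "v < n" and "j \<in> {1..l}"
      using inst verts by (auto simp: mhv_instance_def ran_def)
    then show "p v = Some (c v)" using j g(1)[of "int v"] input_precolour[OF v] c(1)[OF v]
      by (simp add: input_simps)
  qed
  moreover have "k \<le> int (card {v \<in> pverts G. happy G c v})"
    using g(2) happy_card[of ?col c] c(1) by (simp only: input_simps sum_of_bool_card
        finite_atLeastLessThan_int)
  moreover have "c ` pverts G \<subseteq> {1..l}" using c by (auto simp: verts)
  ultimately show "max_happy_vertices G l p k" unfolding max_happy_vertices_def by blast
next
  assume "max_happy_vertices G l p k"
  then obtain c where c: "c ` {..<n} \<subseteq> {1..l}" "extends_colouring c p"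
    "k \<le> int (card {v \<in> pverts G. happy G c v})"
    unfolding max_happy_vertices_def verts by blast
  define cs where "cs v = int (c (nat v))" for v
  have d: "0 \<le> cluster_distance M" using distance_le by simp
  then have dn: "cluster_distance M \<le> M 0"
    by (intro admissible_le) (simp add: admissible_def input_simps)
  have V: "\<exists>u'<n. u = int u'" if "u \<in> {0..<M 0}" for u
    using vertexE[OF that] by blast
  show "solvable M" unfolding solvable_def
  proof (rule happy_guess[where cs = cs])
    show "adj M v u" if "u \<in> {0..<M 0}" "v \<in> {0..<M 0}" "adj M u v" for u v
      using V[OF that(1)] V[OF that(2)] that(3) input_adj arcs_sym by auto
    show "1 \<le> cs v \<and> cs v \<le> M 1" if "v \<in> {0..<M 0}" for v
      using V[OF that] c(1) by (auto simp: cs_def input_simps)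
    show "cs v = precolour M v" if v: "v \<in> {0..<M 0}" "precolour M v \<noteq> 0" for v
    proof -
      obtain u where u: "u < n" "v = int u" using V[OF v(1)] by blast
      then obtain j where "p u = Some j" using v(2) by (cases "p u") (simp_all add: input_precolour)
      moreover from this have "p u = Some (c u)" using c(2) unfolding extends_colouring_def by blast
      ultimately show ?thesis using u by (simp add: cs_def input_precolour)
    qed
    show "M 2 \<le> int (card {v \<in> {0..<M 0}. \<forall>u\<in>{0..<M 0}. adj M u v \<longrightarrow> cs u = cs v})"
      using c(3) happy_card[of cs c] by (simp add: cs_def input_simps)
  qed (use modulator_correct[OF d] d dn in \<open>simp_all add: input_simps\<close>)
qed

end

theorem theorem3:
  shows "\<exists>(P :: instr list) (C :: nat) (e :: nat).
    \<forall>(n :: nat) (G :: nat pair_pre_digraph) (l :: nat) (p :: nat \<rightharpoonup> nat) (k :: int).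
      mhv_instance G l p \<and> pverts G = {..<n} \<longrightarrow>
      ram_decides_within P (mhv_input n G l p k) (max_happy_vertices G l p k)
        (C * (2 * distance_to_cluster G) ^ distance_to_cluster G * (n + 1) ^ e)"
proof -
  obtain x C e where x: "realizes x C e admissible branchings (\<lambda>M v. of_bool (solvable M))"
    using computable_solvable unfolding computable_def by blast
  show ?thesis
  proof (rule exI[of _ "program x"], rule exI[of _ "C + 2"], rule exI[of _ e], intro allI impI,
      elim conjE)
    fix n l :: nat and G :: "nat pair_pre_digraph" and p :: "nat \<rightharpoonup> nat" and k :: int
    assume inst: "mhv_instance G l p" "pverts G = {..<n}"
    define M where "M = mhv_input n G l p k"
    let ?D = "distance_to_cluster G"
    note simps = input_simps[OF inst, of k, folded M_def]
    have d: "0 \<le> cluster_distance M" "cluster_distance M \<le> int ?D"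
      using distance_le[OF inst, of k] by (simp_all add: M_def)
    have adm: "admissible M (\<lambda>_. 0)" using d by (simp add: admissible_def simps)
    note x = realizesD[OF x, OF adm]
    have "ram_decides_within (program x) M (solvable M) (cost M (\<lambda>_. 0) x + 2)"
      by (rule program_decides) (use x simps in auto)
    then have run: "ram_decides_within (program x) M (max_happy_vertices G l p k) (cost M (\<lambda>_. 0)
        x + 2)"
      using solvable_iff[OF inst, of k] by (simp add: M_def)
    \<comment> \<open>Both base and exponent grow with \<open>d\<close>. The case
      \<open>?D = 0\<close> is separate because powers of the base 0 are not monotone in the
      exponent.\<close>
    have le: "branchings M \<le> (2 * ?D) ^ ?D"
    proof (cases "?D = 0")
      case True
      then show ?thesis using d by (simp add: branchings_def)
    next
      case False
      let ?k = "nat (cluster_distance M)"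
      have "branchings M \<le> (2 * ?D) ^ ?k" unfolding branchings_def using d by (intro power_mono) auto
      also have "\<dots> \<le> (2 * ?D) ^ ?D" using d False by (intro power_increasing) auto
      finally show ?thesis .
    qed
    have s: "msize M = n + 1" by (simp add: msize_def simps)
    \<comment> \<open>The product is positive even for \<open>?D = 0\<close>, where the first power
      is 1; hence the two final instructions are absorbed by \<open>C + 2\<close>.\<close>
    have "0 < (2 * ?D) ^ ?D * (n + 1) ^ e" by (cases "?D") simp_all
    then have "2 \<le> 2 * (2 * ?D) ^ ?D * (n + 1) ^ e" by linarith
    moreover have "cost M (\<lambda>_. 0) x \<le> C * (2 * ?D) ^ ?D * (n + 1) ^ e"
      using x(3) mult_le_mono1[OF mult_le_mono2[OF le, of C], of "(n + 1) ^ e"]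
      unfolding s by (rule order_trans)
    ultimately have "cost M (\<lambda>_. 0) x + 2 \<le> (C + 2) * (2 * ?D) ^ ?D * (n + 1) ^ e"
      unfolding distrib_right by linarith
    then show "ram_decides_within (program x) (mhv_input n G l p k) (max_happy_vertices G l p k)
        ((C + 2) * (2 * ?D) ^ ?D * (n + 1) ^ e)"
      using run unfolding ram_decides_within_def M_def by (meson order_trans)
  qed
qed

end
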